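(* Let $\mathbf{V}=\{V^n\}_{n=1}^\infty$ be a general source and $\mathbf{W}=\{W^n\}_{n=1}^\infty$ a general channel. For each $n$ let $X^n$ be any input random variable taking values in $\mathcal{X}^n$, which may be arbitrarily correlated to the source variable $V^n$, and let $Y^n$ be the channel output via $W^n$ due to the channel input $X^n$. Let $\gamma>0$ be an arbitrary positive number. Then, for every $n=1,2,\dots$, there exists a joint source-channel $(n,\varepsilon_n)$ code (for $V^n$ and $W^n$) such that $$\varepsilon_n \le \Pr\left\{\frac1n\log\frac{W^n(Y^n|X^n)}{P_{Y^n}(Y^n)} \le \frac1n\log\frac{1}{P_{V^n}(V^n)}+\gamma\right\}+e^{-n\gamma}.$$
   Context: A general source $\mathbf{V}=\{V^n\}_{n=1}^\infty$ is an arbitrary sequence of random variables $V^n=(V_1^{(n)},\dots,V_n^{(n)})$ with values in $\mathcal{V}^n$, where the source alphabet $\mathcal{V}$ is a countably infinite set; no consistency between different $n$ is required. A general channel $\mathbf{W}=\{W^n(\cdot|\cdot):\mathcal{X}^n\to\mathcal{Y}^n\}_{n=1}^\infty$ is an arbitrary sequence of transition probabilities (Markov kernels) $W^n$ from $\mathcal{X}^n$ to $\mathcal{Y}^n$, where $\mathcal{X},\mathcal{Y}$ are arbitrary abstract (measurable) alphabets. $P_Z$ denotes the distribution of $Z$. Logarithms are natural. "$Y^n$ is the channel output via $W^n$ due to the input $X^n$" means that the conditional distribution of $Y^n$ given $X^n=\mathbf{x}$ is $W^n(\cdot|\mathbf{x})$ and $V^n\to X^n\to Y^n$ is a Markov chain.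 For abstract alphabets, $\frac{W^n(Y^n|X^n)}{P_{Y^n}(Y^n)}$ means $g(Y^n|X^n)$, where $g(\mathbf{y}|\mathbf{x})=\frac{W^n(d\mathbf{y}|\mathbf{x})}{P_{Y^n}(d\mathbf{y})}=\frac{P_{X^nY^n}(d\mathbf{x},d\mathbf{y})}{P_{X^n}(d\mathbf{x})P_{Y^n}(d\mathbf{y})}$ is the Radon-Nikodym derivative, measurable in $(\mathbf{x},\mathbf{y})$. A joint source-channel code is a pair of an encoder $\varphi_n:\mathcal{V}^n\to\mathcal{X}^n$ and a decoder $\psi_n:\mathcal{Y}^n\to\mathcal{V}^n$ (deterministic maps). Its probability of decoding error is $\varepsilon_n=\sum_{\mathbf{v}\in\mathcal{V}^n}P_{V^n}(\mathbf{v})\,W^n(\mathcal{D}^c(\mathbf{v})|\varphi_n(\mathbf{v}))$, where $\mathcal{D}(\mathbf{v})=\{\mathbf{y}\in\mathcal{Y}^n:\psi_n(\mathbf{y})=\mathbf{v}\}$. A pair with error probability $\varepsilon_n$ is called a joint source-channel $(n,\varepsilon_n)$ code. *)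

theory Defs
  imports "HOL-Probability.Probability"
begin

text \<open>The n-fold product alphabet, with the product sigma-algebra. Its points are the
  extensional functions on \<open>{1..n}\<close>. For \<open>S = count_space A\<close> with \<open>A\<close> countable
  all subsets of the product are measurable.\<close>

abbreviation block :: "nat \<Rightarrow> 's measure \<Rightarrow> (nat \<Rightarrow> 's) measure" where
  "block n S \<equiv> (\<Pi>\<^sub>M i\<in>{1..n}. S)"

text \<open>For every blocklength there is a separate underlying probability space \<open>M n\<close>, which will
  also carry the channel input and output; nothing relates different blocklengths.\<close>

definition general_source ::
    "'v set \<Rightarrow> (nat \<Rightarrow> 'a measure) \<Rightarrow> (nat \<Rightarrow> 'a \<Rightarrow> nat \<Rightarrow> 'v) \<Rightarrow> bool" where
  "general_source A M V \<longleftrightarrow> countable A \<and> infinite A \<and>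
     (\<forall>n\<ge>1. prob_space (M n) \<and> V n \<in> M n \<rightarrow>\<^sub>M block n (count_space A))"

definition general_channel ::
    "'x measure \<Rightarrow> 'y measure \<Rightarrow> (nat \<Rightarrow> (nat \<Rightarrow> 'x) \<Rightarrow> (nat \<Rightarrow> 'y) measure) \<Rightarrow> bool" where
  "general_channel SX SY W \<longleftrightarrow> (\<forall>n\<ge>1. W n \<in> block n SX \<rightarrow>\<^sub>M prob_algebra (block n SY))"

definition cond_prob :: "'a measure \<Rightarrow> 'x measure \<Rightarrow> ('a \<Rightarrow> 'x) \<Rightarrow> 'a set \<Rightarrow> 'a \<Rightarrow> real" where
  "cond_prob M SX X E = real_cond_exp M (vimage_algebra (space M) X SX) (indicator E)"

definition has_cond_distr ::
    "'a measure \<Rightarrow> 'x measure \<Rightarrow> 'y measure \<Rightarrow> ('a \<Rightarrow> 'x) \<Rightarrow> ('a \<Rightarrow> 'y) \<Rightarrow> ('x \<Rightarrow> 'y measure) \<Rightarrow> bool" where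
  "has_cond_distr M SX SY X Y K \<longleftrightarrow>
     (\<forall>C\<in>sets SY. AE \<omega> in M. cond_prob M SX X (Y -` C \<inter> space M) \<omega> = measure (K (X \<omega>)) C)"

definition markov_chain ::
    "'a measure \<Rightarrow> 'v measure \<Rightarrow> 'x measure \<Rightarrow> 'y measure \<Rightarrow> ('a \<Rightarrow> 'v) \<Rightarrow> ('a \<Rightarrow> 'x) \<Rightarrow> ('a \<Rightarrow> 'y) \<Rightarrow> bool" where
  "markov_chain M SV SX SY V X Y \<longleftrightarrow>
     (\<forall>B\<in>sets SV. \<forall>C\<in>sets SY. AE \<omega> in M.
        cond_prob M SX X ((V -` B \<inter> space M) \<inter> (Y -` C \<inter> space M)) \<omega> =
        cond_prob M SX X (V -` B \<inter> space M) \<omega> * cond_prob M SX X (Y -` C \<inter> space M) \<omega>)"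

definition channel_output ::
    "'a measure \<Rightarrow> 'v measure \<Rightarrow> 'x measure \<Rightarrow> 'y measure \<Rightarrow> ('x \<Rightarrow> 'y measure) \<Rightarrow>
     ('a \<Rightarrow> 'v) \<Rightarrow> ('a \<Rightarrow> 'x) \<Rightarrow> ('a \<Rightarrow> 'y) \<Rightarrow> bool" where
  "channel_output M SV SX SY K V X Y \<longleftrightarrow>
     Y \<in> M \<rightarrow>\<^sub>M SY \<and> has_cond_distr M SX SY X Y K \<and> markov_chain M SV SX SY V X Y"

text \<open>\<open>g\<close> is a version of \<open>d\<mu>/d\<nu>\<close>. The input is arbitrary, so \<open>P\<^bsub>XY\<^esub>\<close> need not be absolutely
  continuous with respect to the product of its marginals; as usual the derivative is then
  the density of the absolutely continuous part, and is infinite on a \<open>\<nu>\<close>-null set \<open>N\<close>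
  carrying the singular part. If \<open>\<mu>\<close> is absolutely continuous this is the ordinary
  Radon--Nikodym derivative (\<open>is_RN_deriv_absolutely_continuous\<close> below), and a version
  always exists (\<open>is_RN_deriv_exists\<close> below).\<close>

definition is_RN_deriv :: "'a measure \<Rightarrow> 'a measure \<Rightarrow> ('a \<Rightarrow> ennreal) \<Rightarrow> bool" where
  "is_RN_deriv \<nu> \<mu> g \<longleftrightarrow> sets \<mu> = sets \<nu> \<and> g \<in> borel_measurable \<nu> \<and>
     (\<exists>N\<in>null_sets \<nu>. (\<forall>z\<in>N. g z = \<infinity>) \<and>
        (\<forall>B\<in>sets \<nu>. emeasure \<mu> B = (\<integral>\<^sup>+z\<in>B. g z \<partial>\<nu>) + emeasure \<mu> (B \<inter> N)))"

lemma is_RN_deriv_absolutely_continuous: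
  assumes "absolutely_continuous \<nu> \<mu>" and "sets \<mu> = sets \<nu>"
  shows "is_RN_deriv \<nu> \<mu> g \<longleftrightarrow> g \<in> borel_measurable \<nu> \<and> density \<nu> g = \<mu>"
proof
  assume "is_RN_deriv \<nu> \<mu> g"
  then obtain N where g: "g \<in> borel_measurable \<nu>" and N: "N \<in> null_sets \<nu>"
    and eq: "\<And>B. B \<in> sets \<nu> \<Longrightarrow> emeasure \<mu> B = (\<integral>\<^sup>+z\<in>B. g z \<partial>\<nu>) + emeasure \<mu> (B \<inter> N)"
    unfolding is_RN_deriv_def by auto
  have "N \<in> null_sets \<mu>"
    using N assms(1) unfolding absolutely_continuous_def by blast
  then have "emeasure \<mu> (B \<inter> N) = 0" if "B \<in> sets \<nu>" for B
    using null_set_Int1[of N \<mu> B] that assms(2) by (simp add: Int_commute null_setsD1)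
  then have "emeasure (density \<nu> g) B = emeasure \<mu> B" if "B \<in> sets \<nu>" for B
    using that g eq[OF that] by (simp add: emeasure_density)
  then have "density \<nu> g = \<mu>"
    using assms(2) by (intro measure_eqI) simp_all
  with g show "g \<in> borel_measurable \<nu> \<and> density \<nu> g = \<mu>" by blast
next
  assume g: "g \<in> borel_measurable \<nu> \<and> density \<nu> g = \<mu>"
  then have "emeasure \<mu> B = (\<integral>\<^sup>+z\<in>B. g z \<partial>\<nu>)" if "B \<in> sets \<nu>" for B
    using that emeasure_density[of g \<nu> B] by simp
  with g assms(2) show "is_RN_deriv \<nu> \<mu> g"
    unfolding is_RN_deriv_def by (intro conjI bexI[of _ "{}"]) auto
qed

lemma is_RN_deriv_exists:
  assumes "finite_measure \<nu>" and "finite_measure \<mu>" and sets_eq: "sets \<mu> = sets \<nu>"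
  shows "\<exists>g. is_RN_deriv \<nu> \<mu> g"
proof -
  interpret \<nu>: finite_measure \<nu> by fact
  interpret \<mu>: finite_measure \<mu> by fact
  define \<rho> where "\<rho> = measure_of (space \<nu>) (sets \<nu>) (\<lambda>B. emeasure \<mu> B + emeasure \<nu> B)"
  have sets_\<rho>[simp, measurable_cong]: "sets \<rho> = sets \<nu>"
    by (simp add: \<rho>_def)
  have ca: "countably_additive (sets \<nu>) (\<lambda>B. emeasure \<mu> B + emeasure \<nu> B)"
  proof (rule countably_additiveI)
    fix F :: "nat \<Rightarrow> 'a set"
    assume F: "range F \<subseteq> sets \<nu>" "disjoint_family F"
    have "(\<Sum>i. emeasure \<mu> (F i) + emeasure \<nu> (F i)) = (\<Sum>i. emeasure \<mu> (F i)) + (\<Sum>i. emeasure \<nu> (F i))"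
      by (rule suminf_add[symmetric]) auto
    then show "(\<Sum>i. emeasure \<mu> (F i) + emeasure \<nu> (F i)) = emeasure \<mu> (\<Union>i. F i) + emeasure \<nu> (\<Union>i. F i)"
      using F sets_eq by (simp add: suminf_emeasure)
  qed
  have em: "emeasure \<rho> B = emeasure \<mu> B + emeasure \<nu> B" if "B \<in> sets \<nu>" for B
    unfolding \<rho>_def
    by (rule emeasure_measure_of_sigma) (use that ca in \<open>auto simp: positive_def sets.sigma_algebra_axioms\<close>)
  have fin: "finite_measure \<rho>"
    using em[of "space \<nu>"] sets_eq_imp_space_eq[OF sets_\<rho>]
    by (intro finite_measureI) (simp add: \<mu>.emeasure_eq_measure \<nu>.emeasure_eq_measure)
  interpret \<rho>: finite_measure \<rho> by fact
  have "absolutely_continuous \<rho> \<mu>" "absolutely_continuous \<rho> \<nu>"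
    unfolding absolutely_continuous_def null_sets_def using em sets_eq by auto
  then obtain h k where h[measurable]: "h \<in> borel_measurable \<rho>" and dh: "density \<rho> h = \<mu>"
    and k[measurable]: "k \<in> borel_measurable \<rho>" and dk: "density \<rho> k = \<nu>"
    using \<rho>.Radon_Nikodym[of \<mu>] \<rho>.Radon_Nikodym[of \<nu>] sets_eq by auto
  define N where "N = {z\<in>space \<rho>. k z = 0}"
  define g where "g z = (if k z = 0 then \<infinity> else h z / k z)" for z
  have N[measurable]: "N \<in> sets \<rho>" unfolding N_def by measurable
  have g\<rho>[measurable]: "g \<in> borel_measurable \<rho>" unfolding g_def by measurable
  have g: "g \<in> borel_measurable \<nu>" using g\<rho> by (simp cong: measurable_cong_sets)
  have "emeasure \<nu> N = (\<integral>\<^sup>+z. k z * indicator N z \<partial>\<rho>)"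
    using emeasure_density[OF k N] dk by simp
  also have "\<dots> = (\<integral>\<^sup>+z. 0 \<partial>\<rho>)"
    by (intro nn_integral_cong) (auto simp: N_def indicator_def)
  finally have null: "N \<in> null_sets \<nu>" using N by (auto simp: null_sets_def)
  have "(\<integral>\<^sup>+z. k z \<partial>\<rho>) = emeasure \<nu> (space \<rho>)"
    using emeasure_density[OF k sets.top] dk by (simp cong: nn_integral_cong)
  then have "(\<integral>\<^sup>+z. k z \<partial>\<rho>) \<noteq> \<infinity>" by simp
  then have kfin: "AE z in \<rho>. k z \<noteq> \<infinity>"
    by (rule nn_integral_PInf_AE[OF k])
  have "emeasure \<mu> B = (\<integral>\<^sup>+z\<in>B. g z \<partial>\<nu>) + emeasure \<mu> (B \<inter> N)" if "B \<in> sets \<nu>" for B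
  proof -
    have B[measurable]: "B \<in> sets \<rho>" using that by simp
    have "(\<integral>\<^sup>+z\<in>B. g z \<partial>\<nu>) = (\<integral>\<^sup>+z. k z * (g z * indicator B z) \<partial>\<rho>)"
      unfolding dk[symmetric] by (rule nn_integral_density) measurable
    also have "\<dots> = (\<integral>\<^sup>+z. h z * indicator (B - N) z \<partial>\<rho>)"
    proof (rule nn_integral_cong_AE, use kfin AE_space in eventually_elim)
      case (elim z)
      then show ?case
        by (cases "k z = 0")
           (auto simp: g_def N_def indicator_def less_top ennreal_times_divide mult.commute
             ennreal_mult_divide_eq)
    qed
    also have "\<dots> = emeasure \<mu> (B - N)"
      using emeasure_density[OF h sets.Diff[OF B N]] dh by simp
    finally have "(\<integral>\<^sup>+z\<in>B. g z \<partial>\<nu>) + emeasure \<mu> (B \<inter> N) = emeasure \<mu> (B - N) + emeasure \<mu> (B \<inter> N)"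
      by simp
    also have "\<dots> = emeasure \<mu> ((B - N) \<union> (B \<inter> N))"
      by (rule plus_emeasure) (use that N sets_eq in auto)
    also have "(B - N) \<union> (B \<inter> N) = B" by blast
    finally show ?thesis by simp
  qed
  moreover have "\<forall>z\<in>N. g z = \<infinity>" by (simp add: N_def g_def)
  ultimately show ?thesis
    unfolding is_RN_deriv_def using null g sets_eq by blast
qed

text \<open>Natural logarithm with \<open>log 0 = -\<infinity>\<close> and \<open>log \<infinity> = \<infinity>\<close>.\<close>

definition ln_ext :: "ennreal \<Rightarrow> ereal" where
  "ln_ext u = (if u = 0 then -\<infinity> else if u = \<infinity> then \<infinity> else ereal (ln (enn2real u)))"

text \<open>\<open>\<Sum>v. P\<^sub>V(v) W(D\<^sup>c(v) | \<phi>(v))\<close> with \<open>D(v) = {y. \<psi> y = v}\<close>; \<open>PV\<close> is the law of the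
  source block.\<close>

definition decoding_error ::
    "'v measure \<Rightarrow> 'y measure \<Rightarrow> ('x \<Rightarrow> 'y measure) \<Rightarrow> ('v \<Rightarrow> 'x) \<Rightarrow> ('y \<Rightarrow> 'v) \<Rightarrow> real" where
  "decoding_error PV SY K \<phi> \<psi> =
     (\<Sum>\<^sub>\<infinity>v\<in>space PV. measure PV {v} * measure (K (\<phi> v)) {y\<in>space SY. \<psi> y \<noteq> v})"

text \<open>The decoder is measurable, so that the decoding sets are events.\<close>

definition joint_source_channel_code ::
    "'v measure \<Rightarrow> 'x measure \<Rightarrow> 'y measure \<Rightarrow> ('x \<Rightarrow> 'y measure) \<Rightarrow>
     ('v \<Rightarrow> 'x) \<Rightarrow> ('y \<Rightarrow> 'v) \<Rightarrow> real \<Rightarrow> bool" where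
  "joint_source_channel_code PV SX SY K \<phi> \<psi> \<epsilon> \<longleftrightarrow>
     \<phi> \<in> space PV \<rightarrow> space SX \<and> \<psi> \<in> SY \<rightarrow>\<^sub>M PV \<and> \<epsilon> = decoding_error PV SY K \<phi> \<psi>"

end

theory Submission
  imports Defs
begin

text \<open>The proof is a random coding argument for a fixed blocklength, with a codebook adapted to the
  source: to every source word \<open>v\<close> a codeword is drawn independently from the conditional law of
  the input \<open>X\<close> given \<open>V = v\<close>. Correlation between source and input is therefore built into the
  code. The receiver outputs the unique \<open>v\<close> whose codeword \<open>x\<close> satisfies
  \<open>g(x, y) > exp(n \<gamma>) / P(V = v)\<close> for the received word \<open>y\<close>.

  There are two sources of error. Either the word that was sent fails this test; averaged over the
  codebook, source word, codeword and output are distributed as \<open>(V, X, Y)\<close>, so this has the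
  probability on the right-hand side of the theorem (\<open>channel_output_nn_integral\<close> integrates
  out the output along the Markov chain). Or a wrong word \<open>v'\<close> passes
  the test. Its codeword is independent of the output, so by \<open>random_coding\<close> the events to be
  counted concern a pair drawn from the product of \<open>P(X | V = v')\<close> and the law of \<open>Y\<close>. Under
  the product of the marginals of \<open>X\<close> and \<open>Y\<close> the function \<open>g\<close> has mean at most one, and
  \<open>confusion_mass_le\<close> turns this into the bound \<open>exp(- n \<gamma>)\<close> by Markov's inequality: the
  factor \<open>P(V = v')\<close> in the threshold is exactly the weight that recombines the conditional laws
  \<open>P(X | V = v')\<close> into that of \<open>X\<close>, so the sum over infinitely many words stays bounded.

  The mean error over codebooks is thus at most the asserted bound, and some codebook does no worse
  (\<open>exists_le_nn_integral\<close>). Codebooks are points of an infinite product of probability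
  spaces indexed by the countable set of source words.\<close>

section \<open>Decoding by a unique match\<close>

text \<open>The decoder answers \<open>v\<close> when \<open>v\<close> is the only message whose region \<open>T v\<close> contains the
  received word, and some fixed message otherwise. It can thus err only if the true message fails
  to match or a wrong one matches. Restricting \<open>T v\<close> to the words matched by no other message
  makes the regions disjoint, and countability makes the remaining set, hence the decoder,
  measurable.\<close>
lemma unique_match_decoder:
  fixes T :: "'v \<Rightarrow> 'y set"
  assumes "countable \<Omega>" "\<Omega> \<noteq> {}" and T: "\<And>v. v \<in> \<Omega> \<Longrightarrow> T v \<in> sets SY"
  shows "\<exists>\<psi>\<in>SY \<rightarrow>\<^sub>M count_space \<Omega>. \<forall>y\<in>space SY. \<forall>v\<in>\<Omega>.
           \<psi> y \<noteq> v \<longrightarrow> y \<notin> T v \<or> (\<exists>v'\<in>\<Omega> - {v}. y \<in> T v')"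
proof -
  obtain v0 where v0: "v0 \<in> \<Omega>" using \<open>\<Omega> \<noteq> {}\<close> by blast
  define D where "D v = T v - (\<Union>v'\<in>\<Omega> - {v}. T v')" for v
  define \<psi> where "\<psi> y = (if \<exists>v\<in>\<Omega>. y \<in> D v then THE v. v \<in> \<Omega> \<and> y \<in> D v else v0)" for y
  have the: "(THE v. v \<in> \<Omega> \<and> y \<in> D v) = v" if "v \<in> \<Omega>" "y \<in> D v" for v y
    using that by (intro the_equality) (auto simp: D_def)
  have D: "D v \<in> sets SY" if "v \<in> \<Omega>" for v
    unfolding D_def using that T assms(1)
    by (intro sets.Diff sets.countable_UN'') auto
  have fibre: "\<psi> -` {v} \<inter> space SY =
      D v \<union> (if v = v0 then space SY - (\<Union>v'\<in>\<Omega>. D v') else {})" if v: "v \<in> \<Omega>" for v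
  proof (intro set_eqI)
    fix y
    have "y \<in> space SY" if "y \<in> D v" using that D[OF v] sets.sets_into_space by blast
    then show "y \<in> \<psi> -` {v} \<inter> space SY \<longleftrightarrow>
        y \<in> D v \<union> (if v = v0 then space SY - (\<Union>v'\<in>\<Omega>. D v') else {})"
      using v the by (auto simp: \<psi>_def)
  qed
  have "(\<Union>v'\<in>\<Omega>. D v') \<in> sets SY"
    using D assms(1) by (intro sets.countable_UN'') auto
  then have "\<psi> -` {v} \<inter> space SY \<in> sets SY" if "v \<in> \<Omega>" for v
    using fibre[OF that] D[OF that] by auto
  moreover have "\<psi> y \<in> \<Omega>" for y using v0 the by (auto simp: \<psi>_def)
  ultimately have "\<psi> \<in> SY \<rightarrow>\<^sub>M count_space \<Omega>"
    using assms(1) by (auto simp: measurable_count_space_eq_countable)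
  moreover have "y \<notin> T v \<or> (\<exists>v'\<in>\<Omega> - {v}. y \<in> T v')" if "v \<in> \<Omega>" "\<psi> y \<noteq> v" for y v
  proof (rule ccontr)
    assume "\<not> ?thesis"
    then have "y \<in> D v" by (auto simp: D_def)
    then have "\<psi> y = v" using the[OF \<open>v \<in> \<Omega>\<close>] \<open>v \<in> \<Omega>\<close> by (auto simp: \<psi>_def)
    then show False using \<open>\<psi> y \<noteq> v\<close> by simp
  qed
  ultimately show ?thesis by blast
qed

section \<open>Tools for random selection\<close>

text \<open>The step from the ensemble to a single code: some outcome does no worse than the mean. The
  mean may be infinite, in which case every outcome qualifies.\<close>
lemma (in prob_space) exists_le_nn_integral:
  assumes [measurable]: "f \<in> borel_measurable M"
  shows "\<exists>\<omega>\<in>space M. f \<omega> \<le> (\<integral>\<^sup>+\<omega>. f \<omega> \<partial>M)"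
proof (rule ccontr)
  assume "\<not> ?thesis"
  then have above: "(\<integral>\<^sup>+\<omega>. f \<omega> \<partial>M) < f \<omega>" if "\<omega> \<in> space M" for \<omega>
    using that by (auto simp: not_le)
  obtain \<omega> where "\<omega> \<in> space M" using not_empty by blast
  from above[OF this] have fin: "integral\<^sup>N M f \<noteq> \<infinity>"
    by (auto simp: less_top[symmetric])
  have "\<not> (AE \<omega> in M. f \<omega> \<le> integral\<^sup>N M f)"
  proof
    assume "AE \<omega> in M. f \<omega> \<le> integral\<^sup>N M f"
    then have "AE \<omega> in M. False" using AE_space by eventually_elim (use above in force)
    then show False by simp
  qed
  then have "(\<integral>\<^sup>+\<omega>. integral\<^sup>N M f \<partial>M) < integral\<^sup>N M f"
    using above fin by (intro nn_integral_less) (auto simp: emeasure_space_1 intro!: AE_I2 less_imp_le)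
  then show False by (simp add: emeasure_space_1)
qed

text \<open>Independence of the codewords of two distinct messages, when infinitely many codewords are
  drawn at once.\<close>
lemma (in product_prob_space) distr_pair_of_coordinates:
  assumes "i \<in> I" "j \<in> I" "i \<noteq> j"
  shows "distr (PiM I M) (M i \<Otimes>\<^sub>M M j) (\<lambda>\<omega>. (\<omega> i, \<omega> j)) = M i \<Otimes>\<^sub>M M j"
proof (rule pair_measure_eqI[symmetric])
  fix A B assume A: "A \<in> sets (M i)" and B: "B \<in> sets (M j)"
  have [measurable]: "(\<lambda>\<omega>. \<omega> i) \<in> PiM I M \<rightarrow>\<^sub>M M i" "(\<lambda>\<omega>. \<omega> j) \<in> PiM I M \<rightarrow>\<^sub>M M j"
    using assms by auto
  have "(\<lambda>\<omega>. (\<omega> i, \<omega> j)) -` (A \<times> B) \<inter> space (PiM I M) =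
      {\<omega>\<in>space (PiM I M). \<forall>k\<in>{i, j}. \<omega> k \<in> (if k = i then A else B)}"
    using assms by auto
  moreover have "(if k = i then A else B) \<in> sets (M k)" if "k \<in> {i, j}" for k
    using that A B by auto
  ultimately have "emeasure (distr (PiM I M) (M i \<Otimes>\<^sub>M M j) (\<lambda>\<omega>. (\<omega> i, \<omega> j))) (A \<times> B) =
      (\<Prod>k\<in>{i, j}. emeasure (M k) (if k = i then A else B))"
    using A B assms emeasure_PiM_Collect[of "{i, j}" "\<lambda>k. if k = i then A else B"]
    by (simp add: emeasure_distr)
  then show "emeasure (M i) A * emeasure (M j) B =
      emeasure (distr (PiM I M) (M i \<Otimes>\<^sub>M M j) (\<lambda>\<omega>. (\<omega> i, \<omega> j))) (A \<times> B)"
    using assms by simp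
qed (simp_all add: M.sigma_finite_measure_axioms)

text \<open>The law of the codeword of message \<open>v\<close>. Since the message is discrete, the conditional law of
  \<open>X\<close> given \<open>V = v\<close> exists on an arbitrary measurable space as a normalised
  restriction. When \<open>V = v\<close> has probability zero both sides vanish, and the law of \<open>X\<close> is taken as
  a default, so that every index carries a probability measure.\<close>
lemma conditional_law_given_atom:
  assumes "prob_space M" and V: "V \<in> M \<rightarrow>\<^sub>M count_space \<Omega>" and X: "X \<in> M \<rightarrow>\<^sub>M SX"
  shows "\<exists>Q. prob_space Q \<and> sets Q = sets SX \<and> (\<forall>f\<in>borel_measurable SX.
           emeasure M (V -` {v} \<inter> space M) * (\<integral>\<^sup>+x. f x \<partial>Q) =
           (\<integral>\<^sup>+\<omega>. indicator {v} (V \<omega>) * f (X \<omega>) \<partial>M))"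
proof -
  interpret prob_space M by fact
  note X[measurable]
  define E where "E = V -` {v} \<inter> space M"
  have "E = V -` ({v} \<inter> \<Omega>) \<inter> space M"
    using measurable_space[OF V] by (auto simp: E_def)
  then have E[measurable]: "E \<in> sets M"
    using measurable_sets[OF V, of "{v} \<inter> \<Omega>"] by simp
  have ind: "(\<integral>\<^sup>+\<omega>. indicator {v} (V \<omega>) * f (X \<omega>) \<partial>M) = (\<integral>\<^sup>+\<omega>. f (X \<omega>) * indicator E \<omega> \<partial>M)" for f
    by (intro nn_integral_cong) (auto simp: E_def indicator_def)
  show ?thesis
  proof (cases "emeasure M E = 0")
    case True
    then have "AE \<omega> in M. \<omega> \<notin> E" using E by (intro AE_not_in) (auto simp: null_sets_def)
    then have "(\<integral>\<^sup>+\<omega>. f (X \<omega>) * indicator E \<omega> \<partial>M) = (\<integral>\<^sup>+\<omega>. 0 \<partial>M)" for f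
      by (intro nn_integral_cong_AE) auto
    then show ?thesis
      using True X by (intro exI[of _ "distr M SX X"])
        (auto simp: ind E_def[symmetric] intro: prob_space_distr)
  next
    case False
    interpret U: prob_space "uniform_measure M E"
      using False by (intro prob_space_uniform_measure) auto
    have "emeasure M E * (\<integral>\<^sup>+x. f x \<partial>distr (uniform_measure M E) SX X) =
        (\<integral>\<^sup>+\<omega>. f (X \<omega>) * indicator E \<omega> \<partial>M)" if [measurable]: "f \<in> borel_measurable SX" for f
      using False by (simp add: nn_integral_distr nn_integral_uniform_measure
        ennreal_times_divide ennreal_mult_divide_eq mult.commute[of "emeasure M E"])
    then show ?thesis
      by (intro exI[of _ "distr (uniform_measure M E) SX X"])
         (auto simp: ind E_def[symmetric] intro!: U.prob_space_distr)
  qed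
qed

section \<open>Integrating over the channel output\<close>

text \<open>This is where the Markov property enters. With \<open>a\<close>, \<open>b\<close> the indicators of \<open>V \<in> B\<close> and
  \<open>Y \<in> C\<close>, conditioning on \<open>X\<close> replaces the product \<open>ab\<close> by \<open>E[a|X] E[b|X] = E[a|X] K(X)(C)\<close>.
  The last factor is a function of \<open>X\<close>, so it can be moved back inside the conditional
  expectation of \<open>a\<close>, which is then removed again.\<close>
lemma channel_output_rectangle:
  assumes "prob_space M" and V: "V \<in> M \<rightarrow>\<^sub>M SV" and X: "X \<in> M \<rightarrow>\<^sub>M SX"
    and K: "K \<in> SX \<rightarrow>\<^sub>M prob_algebra SY" and out: "channel_output M SV SX SY K V X Y"
    and B: "B \<in> sets SV" and D: "D \<in> sets SX" and C: "C \<in> sets SY"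
  shows "(\<integral>\<^sup>+\<omega>. indicator B (V \<omega>) * (indicator D (X \<omega>) * indicator C (Y \<omega>)) \<partial>M) =
    (\<integral>\<^sup>+\<omega>. indicator B (V \<omega>) * (indicator D (X \<omega>) * emeasure (K (X \<omega>)) C) \<partial>M)"
proof -
  interpret prob_space M by fact
  have Y: "Y \<in> M \<rightarrow>\<^sub>M SY" using out by (simp add: channel_output_def)
  note [measurable] = V X Y B D C
  define F where "F = vimage_algebra (space M) X SX"
  have X_F[measurable]: "X \<in> F \<rightarrow>\<^sub>M SX"
    unfolding F_def using measurable_space[OF X] by (intro measurable_vimage_algebra1) auto
  have sub: "subalgebra M F"
    using measurable_space[OF X] X
    by (auto simp: subalgebra_def F_def sets_vimage_algebra2 Pi_iff)
  interpret F: finite_measure_subalgebra M F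
    by unfold_locales (rule sub)
  let ?a = "\<lambda>\<omega>. indicator (V -` B \<inter> space M) \<omega> :: real"
  let ?b = "\<lambda>\<omega>. indicator (Y -` C \<inter> space M) \<omega> :: real"
  let ?ab = "\<lambda>\<omega>. indicator (V -` B \<inter> space M \<inter> (Y -` C \<inter> space M)) \<omega> :: real"
  let ?d = "\<lambda>\<omega>. indicator D (X \<omega>) :: real"
  let ?k = "\<lambda>\<omega>. measure (K (X \<omega>)) C"
  have kX[measurable]: "(\<lambda>x. measure (K x) C) \<in> borel_measurable SX"
    using measurable_compose[OF K measurable_measure_prob_algebra[OF C]] .
  have K_prob: "prob_space (K (X \<omega>))" "sets (K (X \<omega>)) = sets SY" if "\<omega> \<in> space M" for \<omega>
    using measurable_space[OF K measurable_space[OF X that]] by (auto simp: space_prob_algebra)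
  have k01: "?k \<omega> \<le> 1" if "\<omega> \<in> space M" for \<omega>
    using K_prob(1)[OF that] by (rule prob_space.prob_le_1)
  have int: "integrable M (\<lambda>\<omega>. ?d \<omega> * ?k \<omega> * ?a \<omega>)" "integrable M (\<lambda>\<omega>. ?d \<omega> * ?ab \<omega>)"
    using k01 by (auto intro!: integrable_const_bound[of _ 1] simp: indicator_def)
  have "(\<integral>\<omega>. ?d \<omega> * ?ab \<omega> \<partial>M) = (\<integral>\<omega>. ?d \<omega> * real_cond_exp M F ?ab \<omega> \<partial>M)"
    by (rule F.real_cond_exp_intg(2)[symmetric]) (use int in auto)
  also have "\<dots> = (\<integral>\<omega>. ?d \<omega> * ?k \<omega> * real_cond_exp M F ?a \<omega> \<partial>M)"
  proof (rule integral_cong_AE)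
    have "AE \<omega> in M. real_cond_exp M F ?ab \<omega> = real_cond_exp M F ?a \<omega> * real_cond_exp M F ?b \<omega>"
      using out B C unfolding channel_output_def markov_chain_def cond_prob_def F_def by blast
    moreover have "AE \<omega> in M. real_cond_exp M F ?b \<omega> = ?k \<omega>"
      using out C unfolding channel_output_def has_cond_distr_def cond_prob_def F_def by blast
    ultimately show "AE \<omega> in M. ?d \<omega> * real_cond_exp M F ?ab \<omega> =
        ?d \<omega> * ?k \<omega> * real_cond_exp M F ?a \<omega>"
      by eventually_elim simp
  qed auto
  also have "\<dots> = (\<integral>\<omega>. ?d \<omega> * ?k \<omega> * ?a \<omega> \<partial>M)"
    by (rule F.real_cond_exp_intg(2)) (use int in auto)
  finally have eq: "(\<integral>\<omega>. ?d \<omega> * ?ab \<omega> \<partial>M) = (\<integral>\<omega>. ?d \<omega> * ?k \<omega> * ?a \<omega> \<partial>M)" .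
  have "(\<integral>\<^sup>+\<omega>. indicator B (V \<omega>) * (indicator D (X \<omega>) * indicator C (Y \<omega>)) \<partial>M) =
      (\<integral>\<^sup>+\<omega>. ennreal (?d \<omega> * ?ab \<omega>) \<partial>M)"
    by (intro nn_integral_cong) (auto simp: indicator_def)
  also have "\<dots> = (\<integral>\<^sup>+\<omega>. ennreal (?d \<omega> * ?k \<omega> * ?a \<omega>) \<partial>M)"
    using int eq by (subst (1 2) nn_integral_eq_integral) auto
  also have "\<dots> = (\<integral>\<^sup>+\<omega>. indicator B (V \<omega>) * (indicator D (X \<omega>) * emeasure (K (X \<omega>)) C) \<partial>M)"
    using finite_measure.emeasure_eq_measure[OF prob_space.finite_measure[OF K_prob(1)]]
    by (intro nn_integral_cong) (auto simp: indicator_def)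
  finally show ?thesis .
qed

text \<open>On the event \<open>V \<in> B\<close> the output may be integrated out with the kernel at the input \<open>X\<close>.
  Both sides are integrals of \<open>f\<close> against finite measures on the product space, the right-hand one
  being the composition of a restriction of \<open>M\<close> with a kernel. By the previous lemma they agree on
  rectangles, hence everywhere.\<close>
lemma channel_output_nn_integral:
  assumes "prob_space M" and V: "V \<in> M \<rightarrow>\<^sub>M SV" and X: "X \<in> M \<rightarrow>\<^sub>M SX"
    and K: "K \<in> SX \<rightarrow>\<^sub>M prob_algebra SY" and out: "channel_output M SV SX SY K V X Y"
    and B: "B \<in> sets SV" and f: "f \<in> borel_measurable (SX \<Otimes>\<^sub>M SY)"
  shows "(\<integral>\<^sup>+\<omega>. indicator B (V \<omega>) * f (X \<omega>, Y \<omega>) \<partial>M) =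
    (\<integral>\<^sup>+\<omega>. indicator B (V \<omega>) * (\<integral>\<^sup>+y. f (X \<omega>, y) \<partial>K (X \<omega>)) \<partial>M)"
proof -
  interpret prob_space M by fact
  have Y: "Y \<in> M \<rightarrow>\<^sub>M SY" using out by (simp add: channel_output_def)
  have K'[measurable]: "K \<in> SX \<rightarrow>\<^sub>M subprob_algebra SY"
    using K by (rule measurable_prob_algebraD)
  note [measurable] = V X Y B f
  define R where "R = density M (\<lambda>\<omega>. indicator B (V \<omega>))"
  have sets_R[measurable_cong, simp]: "sets R = sets M" and [simp]: "space R = space M"
    by (auto simp: R_def)
  have R: "(\<integral>\<^sup>+\<omega>. h \<omega> \<partial>R) = (\<integral>\<^sup>+\<omega>. indicator B (V \<omega>) * h \<omega> \<partial>M)" if "h \<in> borel_measurable M" for h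
    unfolding R_def using that by (intro nn_integral_density) auto
  define J where "J \<omega> = distr (K (X \<omega>)) (SX \<Otimes>\<^sub>M SY) (Pair (X \<omega>))" for \<omega>
  have J[measurable]: "J \<in> M \<rightarrow>\<^sub>M subprob_algebra (SX \<Otimes>\<^sub>M SY)"
    unfolding J_def by (rule measurable_distr2[where M = SY]) auto
  have J_R: "J \<in> R \<rightarrow>\<^sub>M subprob_algebra (SX \<Otimes>\<^sub>M SY)" by simp
  have K_meas: "sets (K (X \<omega>)) = sets SY" if "\<omega> \<in> space M" for \<omega>
    using measurable_space[OF K measurable_space[OF X that]] by (auto simp: space_prob_algebra)
  have J_int: "(\<integral>\<^sup>+z. h z \<partial>J \<omega>) = (\<integral>\<^sup>+y. h (X \<omega>, y) \<partial>K (X \<omega>))"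
    if "\<omega> \<in> space M" "h \<in> borel_measurable (SX \<Otimes>\<^sub>M SY)" for \<omega> h
    unfolding J_def using that measurable_space[OF X]
    by (subst nn_integral_distr) (auto cong: measurable_cong_sets simp: K_meas)
  have J_meas: "(\<lambda>\<omega>. \<integral>\<^sup>+z. h z \<partial>J \<omega>) \<in> borel_measurable M" if "h \<in> borel_measurable (SX \<Otimes>\<^sub>M SY)" for h
    using measurable_compose[OF J nn_integral_measurable_subprob_algebra[OF that]] .
  have sets_RJ: "sets (R \<bind> J) = sets (SX \<Otimes>\<^sub>M SY)"
    by (rule sets_bind) (use sets_kernel[OF J_R] not_empty in auto)
  let ?E = "{D \<times> C | D C. D \<in> sets SX \<and> C \<in> sets SY}"
  have "distr R (SX \<Otimes>\<^sub>M SY) (\<lambda>\<omega>. (X \<omega>, Y \<omega>)) = R \<bind> J"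
  proof (rule measure_eqI_generator_eq[OF Int_stable_pair_measure_generator])
    show "?E \<subseteq> Pow (space SX \<times> space SY)"
      by (rule pair_measure_closed)
    show "sets (distr R (SX \<Otimes>\<^sub>M SY) (\<lambda>\<omega>. (X \<omega>, Y \<omega>))) = sigma_sets (space SX \<times> space SY) ?E"
      by (simp add: sets_pair_measure)
    show "sets (R \<bind> J) = sigma_sets (space SX \<times> space SY) ?E"
      by (simp add: sets_RJ sets_pair_measure)
    show "range (\<lambda>i::nat. space SX \<times> space SY) \<subseteq> ?E" by auto
    show "(\<Union>i::nat. space SX \<times> space SY) = space SX \<times> space SY" by simp
    show "emeasure (distr R (SX \<Otimes>\<^sub>M SY) (\<lambda>\<omega>. (X \<omega>, Y \<omega>))) (space SX \<times> space SY) \<noteq> \<infinity>" for i :: nat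
    proof -
      have "emeasure (distr R (SX \<Otimes>\<^sub>M SY) (\<lambda>\<omega>. (X \<omega>, Y \<omega>))) (space SX \<times> space SY) \<le>
          emeasure R (space R)"
        by (subst emeasure_distr) (auto intro!: emeasure_mono)
      also have "\<dots> = (\<integral>\<^sup>+\<omega>. indicator B (V \<omega>) * 1 \<partial>M)"
        using R[of "\<lambda>_. 1"] by simp
      also have "\<dots> \<le> (\<integral>\<^sup>+\<omega>. 1 \<partial>M)"
        by (intro nn_integral_mono) (auto simp: indicator_def)
      also have "\<dots> = 1" by (simp add: emeasure_space_1)
      finally show ?thesis by (auto simp: top_unique)
    qed
    fix Z assume "Z \<in> ?E"
    then obtain D C where Z: "Z = D \<times> C" and [measurable]: "D \<in> sets SX" "C \<in> sets SY" by blast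
    then have [measurable]: "Z \<in> sets (SX \<Otimes>\<^sub>M SY)" by simp
    have "emeasure (distr R (SX \<Otimes>\<^sub>M SY) (\<lambda>\<omega>. (X \<omega>, Y \<omega>))) Z =
        (\<integral>\<^sup>+\<omega>. indicator Z (X \<omega>, Y \<omega>) \<partial>R)"
      by (subst nn_integral_distr[where f = "indicator Z" and M' = "SX \<Otimes>\<^sub>M SY", symmetric]) auto
    also have "\<dots> = (\<integral>\<^sup>+\<omega>. indicator B (V \<omega>) * (indicator D (X \<omega>) * indicator C (Y \<omega>)) \<partial>M)"
      by (subst R) (auto simp: Z indicator_times)
    also have "\<dots> = (\<integral>\<^sup>+\<omega>. indicator B (V \<omega>) * (indicator D (X \<omega>) * emeasure (K (X \<omega>)) C) \<partial>M)"
      using assms by (intro channel_output_rectangle) auto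
    also have "\<dots> = (\<integral>\<^sup>+\<omega>. indicator B (V \<omega>) * (\<integral>\<^sup>+z. indicator Z z \<partial>J \<omega>) \<partial>M)"
    proof (intro nn_integral_cong arg_cong2[where f = "(*)"] refl)
      fix \<omega> assume \<omega>: "\<omega> \<in> space M"
      have "(\<integral>\<^sup>+z. indicator Z z \<partial>J \<omega>) = (\<integral>\<^sup>+y. indicator D (X \<omega>) * indicator C y \<partial>K (X \<omega>))"
        using \<omega> by (subst J_int) (auto simp: Z indicator_times)
      then show "indicator D (X \<omega>) * emeasure (K (X \<omega>)) C = (\<integral>\<^sup>+z. indicator Z z \<partial>J \<omega>)"
        using \<omega> nn_integral_cmult_indicator[of C "K (X \<omega>)" "indicator D (X \<omega>)"]
        by (simp only: K_meas \<open>C \<in> sets SY\<close> simp_thms)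
    qed
    also have "\<dots> = (\<integral>\<^sup>+\<omega>. \<integral>\<^sup>+z. indicator Z z \<partial>J \<omega> \<partial>R)"
      by (rule R[symmetric]) (rule J_meas, simp)
    also have "\<dots> = (\<integral>\<^sup>+z. indicator Z z \<partial>(R \<bind> J))"
      by (rule nn_integral_bind[OF _ J_R, symmetric]) simp
    also have "\<dots> = emeasure (R \<bind> J) Z"
      by (intro nn_integral_indicator) (simp add: sets_RJ)
    finally show "emeasure (distr R (SX \<Otimes>\<^sub>M SY) (\<lambda>\<omega>. (X \<omega>, Y \<omega>))) Z = emeasure (R \<bind> J) Z" .
  qed
  then have "(\<integral>\<^sup>+z. f z \<partial>distr R (SX \<Otimes>\<^sub>M SY) (\<lambda>\<omega>. (X \<omega>, Y \<omega>))) = (\<integral>\<^sup>+\<omega>. \<integral>\<^sup>+z. f z \<partial>J \<omega> \<partial>R)"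
    using nn_integral_bind[OF f J_R] by simp
  also have "\<dots> = (\<integral>\<^sup>+\<omega>. indicator B (V \<omega>) * (\<integral>\<^sup>+z. f z \<partial>J \<omega>) \<partial>M)"
    by (rule R) (rule J_meas[OF f])
  also have "\<dots> = (\<integral>\<^sup>+\<omega>. indicator B (V \<omega>) * (\<integral>\<^sup>+y. f (X \<omega>, y) \<partial>K (X \<omega>)) \<partial>M)"
    using f by (intro nn_integral_cong) (simp add: J_int)
  finally show ?thesis
    by (simp add: nn_integral_distr R)
qed

section \<open>The random coding bound\<close>

text \<open>Passing to an extended integral makes exchanges with other integrals unconditional. Only an
  inequality is claimed, because \<open>measure\<close> is zero where \<open>emeasure\<close> is infinite; all finite partial
  sums lie below the right-hand side, which gives summability as well.\<close>
lemma decoding_error_le_nn_integral: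
  "ennreal (decoding_error PV SY K \<phi> \<psi>) \<le>
     (\<integral>\<^sup>+v. emeasure PV {v} * emeasure (K (\<phi> v)) {y\<in>space SY. \<psi> y \<noteq> v} \<partial>count_space (space PV))"
    (is "_ \<le> ?R")
proof (cases "?R = \<infinity>")
  case False
  then obtain b where b: "0 \<le> b" "?R = ennreal b" by (cases ?R) auto
  let ?f = "\<lambda>v. measure PV {v} * measure (K (\<phi> v)) {y\<in>space SY. \<psi> y \<noteq> v}"
  have fin: "sum ?f F \<le> b" if F: "finite F" "F \<subseteq> space PV" for F
  proof -
    have "ennreal (sum ?f F) = (\<Sum>v\<in>F. ennreal (measure PV {v}) *
        ennreal (measure (K (\<phi> v)) {y\<in>space SY. \<psi> y \<noteq> v}))"
      by (subst sum_ennreal[symmetric]) (auto simp: ennreal_mult)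
    also have "\<dots> \<le> (\<Sum>v\<in>F. emeasure PV {v} * emeasure (K (\<phi> v)) {y\<in>space SY. \<psi> y \<noteq> v})"
      by (intro sum_mono mult_mono) (auto simp: measure_def ennreal_enn2real_if)
    also have "\<dots> = (\<integral>\<^sup>+v. emeasure PV {v} * emeasure (K (\<phi> v)) {y\<in>space SY. \<psi> y \<noteq> v} * indicator F v
        \<partial>count_space (space PV))"
      using F by (subst nn_integral_count_space'[of F]) auto
    also have "\<dots> \<le> ?R"
      by (intro nn_integral_mono) (auto simp: indicator_def)
    finally show ?thesis using b by simp
  qed
  have "?f summable_on space PV"
    using fin by (intro nonneg_bdd_above_summable_on bdd_aboveI2[where M = b]) auto
  then have "infsum ?f (space PV) \<le> b"
    using fin by (rule infsum_le_finite_sums)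
  then show ?thesis
    using b by (simp add: decoding_error_def ennreal_leI)
qed simp

lemma borel_measurable_nn_integral_count_space:
  fixes f :: "'i \<Rightarrow> 'a \<Rightarrow> ennreal"
  assumes "countable I" and [measurable]: "\<And>i. i \<in> I \<Longrightarrow> f i \<in> borel_measurable M"
  shows "(\<lambda>x. \<integral>\<^sup>+i. f i x \<partial>count_space I) \<in> borel_measurable M"
proof (cases "finite I")
  case True
  then show ?thesis by (simp add: nn_integral_count_space_finite)
next
  case False
  then have [simp]: "I \<noteq> {}" by auto
  have "(\<integral>\<^sup>+i. f i x \<partial>count_space I) = (\<Sum>n. f (from_nat_into I n) x)" for x
    using nn_integral_bij_count_space[OF bij_betw_from_nat_into[OF \<open>countable I\<close> False], of "\<lambda>i. f i x"]
    by (simp add: nn_integral_count_space_nat)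
  then show ?thesis by (simp add: from_nat_into)
qed

text \<open>Draw the codewords \<open>\<phi> v\<close> independently from the conditional laws \<open>Q v\<close>; unique-match
  decoding bounds the error of each draw by \<open>J \<phi>\<close>. For the true message \<open>v\<close> the pair of codeword
  and output behaves as \<open>(X, Y)\<close> given \<open>V = v\<close>, which gives the first term. A wrong codeword
  \<open>\<phi> v'\<close> is independent of that pair, so in the mean over the true message the word received is
  simply \<open>Y\<close>, whatever its dependence on the message; hence in the second term codeword and output
  are independent.\<close>
lemma random_coding:
  fixes V :: "'a \<Rightarrow> 'v" and X :: "'a \<Rightarrow> 'x" and Y :: "'a \<Rightarrow> 'y"
  assumes "prob_space M" and \<Omega>: "countable \<Omega>"
    and V: "V \<in> M \<rightarrow>\<^sub>M count_space \<Omega>" and X: "X \<in> M \<rightarrow>\<^sub>M SX"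
    and K: "K \<in> SX \<rightarrow>\<^sub>M prob_algebra SY"
    and out: "channel_output M (count_space \<Omega>) SX SY K V X Y"
    and S: "\<And>v. v \<in> \<Omega> \<Longrightarrow> S v \<in> sets (SX \<Otimes>\<^sub>M SY)"
    and Q: "\<And>v. prob_space (Q v)" "\<And>v. sets (Q v) = sets SX"
    and Q_int: "\<And>v f. f \<in> borel_measurable SX \<Longrightarrow>
      emeasure M (V -` {v} \<inter> space M) * (\<integral>\<^sup>+x. f x \<partial>Q v) =
      (\<integral>\<^sup>+\<omega>. indicator {v} (V \<omega>) * f (X \<omega>) \<partial>M)"
  shows "\<exists>\<phi>\<in>\<Omega> \<rightarrow> space SX. \<exists>\<psi>\<in>SY \<rightarrow>\<^sub>M count_space \<Omega>.
    ennreal (decoding_error (distr M (count_space \<Omega>) V) SY K \<phi> \<psi>) \<le>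
      (\<integral>\<^sup>+\<omega>. indicator (- S (V \<omega>)) (X \<omega>, Y \<omega>) \<partial>M) +
      (\<integral>\<^sup>+v. \<integral>\<^sup>+x. \<integral>\<^sup>+\<omega>. indicator (S v) (x, Y \<omega>) \<partial>M \<partial>Q v \<partial>count_space \<Omega>)"
proof -
  interpret prob_space M by fact
  interpret Qv: prob_space "Q v" for v by (rule Q(1))
  interpret Q: product_prob_space Q \<Omega> by unfold_locales
  have Y: "Y \<in> M \<rightarrow>\<^sub>M SY" using out by (simp add: channel_output_def)
  have K'[measurable]: "K \<in> SX \<rightarrow>\<^sub>M subprob_algebra SY"
    using K by (rule measurable_prob_algebraD)
  have V_in: "V \<omega> \<in> \<Omega>" if "\<omega> \<in> space M" for \<omega> using measurable_space[OF V that] by simp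
  note [measurable] = V X Y
  note Q(2)[measurable_cong]
  define p where "p v = emeasure M (V -` {v} \<inter> space M)" for v
  have p: "emeasure (distr M (count_space \<Omega>) V) {v} = p v" if "v \<in> \<Omega>" for v
    using that by (simp add: p_def emeasure_distr)
  have K_sets: "sets (K x) = sets SY" if "x \<in> space SX" for x
    using measurable_space[OF K that] by (auto simp: space_prob_algebra)
  have S_meas[measurable]: "(indicator (S v) :: _ \<Rightarrow> ennreal) \<in> borel_measurable (SX \<Otimes>\<^sub>M SY)"
    "(indicator (- S v) :: _ \<Rightarrow> ennreal) \<in> borel_measurable (SX \<Otimes>\<^sub>M SY)" if "v \<in> \<Omega>" for v
    using S[OF that] sets.compl_sets[OF S[OF that]]
    by (auto simp: borel_measurable_indicator_iff Diff_eq Int_commute)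
  \<comment> \<open>In \<open>clash v' (x', x)\<close> the codeword \<open>x\<close> is sent, and \<open>x'\<close> is the codeword of the wrong
    message \<open>v'\<close>; integrating over \<open>x\<close> first then matches the order needed for the marginal of \<open>Y\<close>.\<close>
  define miss where "miss v x = (\<integral>\<^sup>+y. indicator (- S v) (x, y) \<partial>K x)" for v x
  define clash where "clash v' z = (\<integral>\<^sup>+y. indicator (S v') (fst z, y) \<partial>K (snd z))" for v' z
  have miss[measurable]: "miss v \<in> borel_measurable SX" if "v \<in> \<Omega>" for v
    unfolding miss_def using that
    by (intro nn_integral_measurable_subprob_algebra2[where N = SY]) auto
  have clash[measurable]: "clash v \<in> borel_measurable (SX \<Otimes>\<^sub>M SX)" if "v \<in> \<Omega>" for v
    unfolding clash_def using that
    by (intro nn_integral_measurable_subprob_algebra2[where N = SY])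
       (auto simp: split_def intro!: measurable_compose[OF _ S_meas(1)])
  define J where "J \<phi> = (\<integral>\<^sup>+v. p v * (miss v (\<phi> v) +
      (\<integral>\<^sup>+v'. clash v' (\<phi> v', \<phi> v) \<partial>count_space (\<Omega> - {v}))) \<partial>count_space \<Omega>)" for \<phi>
  have code: "\<exists>\<psi>\<in>SY \<rightarrow>\<^sub>M count_space \<Omega>.
      ennreal (decoding_error (distr M (count_space \<Omega>) V) SY K \<phi> \<psi>) \<le> J \<phi>"
    if \<phi>: "\<And>v. v \<in> \<Omega> \<Longrightarrow> \<phi> v \<in> space SX" for \<phi>
  proof -
    have T: "Pair (\<phi> v) -` S v \<in> sets SY" if "v \<in> \<Omega>" for v
      using sets_Pair1[OF S[OF that]] .
    have "\<Omega> \<noteq> {}" using V_in not_empty by blast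
    obtain \<psi> where \<psi>[measurable]: "\<psi> \<in> SY \<rightarrow>\<^sub>M count_space \<Omega>"
      and \<psi>_err: "\<forall>y\<in>space SY. \<forall>v\<in>\<Omega>. \<psi> y \<noteq> v \<longrightarrow>
        y \<notin> Pair (\<phi> v) -` S v \<or> (\<exists>v'\<in>\<Omega> - {v}. y \<in> Pair (\<phi> v') -` S v')"
      using unique_match_decoder[where T = "\<lambda>v. Pair (\<phi> v) -` S v", OF \<Omega> \<open>\<Omega> \<noteq> {}\<close> T] ..
    have err: "\<exists>v'\<in>\<Omega> - {v}. (\<phi> v', y) \<in> S v'"
      if "y \<in> space SY" "v \<in> \<Omega>" "\<psi> y \<noteq> v" "(\<phi> v, y) \<in> S v" for y v
      using \<psi>_err[rule_format, OF that(1-3)] that(4) by simp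
    have "emeasure (K (\<phi> v)) {y\<in>space SY. \<psi> y \<noteq> v} \<le> miss v (\<phi> v) +
        (\<integral>\<^sup>+v'. clash v' (\<phi> v', \<phi> v) \<partial>count_space (\<Omega> - {v}))" if v: "v \<in> \<Omega>" for v
    proof -
      have K_v: "sets (K (\<phi> v)) = sets SY" using K_sets \<phi> v by simp
      have sp: "space (K (\<phi> v)) = space SY" by (rule sets_eq_imp_space_eq) fact
      have ind_meas: "(\<lambda>y. indicator (S v') (\<phi> v', y) :: ennreal) \<in> borel_measurable (K (\<phi> v))"
        "(\<lambda>y. indicator (- S v') (\<phi> v', y) :: ennreal) \<in> borel_measurable (K (\<phi> v))"
        if "v' \<in> \<Omega>" for v'
      proof -
        have "Pair (\<phi> v') \<in> K (\<phi> v) \<rightarrow>\<^sub>M SX \<Otimes>\<^sub>M SY"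
          unfolding measurable_cong_sets[OF K_v refl] by (rule measurable_Pair1') (rule \<phi>[OF that])
        then show "(\<lambda>y. indicator (S v') (\<phi> v', y) :: ennreal) \<in> borel_measurable (K (\<phi> v))"
          "(\<lambda>y. indicator (- S v') (\<phi> v', y) :: ennreal) \<in> borel_measurable (K (\<phi> v))"
          using that by (auto intro: measurable_compose S_meas)
      qed
      have pw: "indicator {y\<in>space SY. \<psi> y \<noteq> v} y \<le> indicator (- S v) (\<phi> v, y) +
          (\<integral>\<^sup>+v'. indicator (S v') (\<phi> v', y) \<partial>count_space (\<Omega> - {v}))" (is "_ \<le> ?a + ?b")
        if y: "y \<in> space SY" for y
      proof (cases "\<psi> y \<noteq> v \<and> (\<phi> v, y) \<in> S v")
        case True
        then obtain v' where v': "v' \<in> \<Omega> - {v}" "(\<phi> v', y) \<in> S v'" using err[OF y v] by (elim conjE) blast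
        have "(1::ennreal) = (\<integral>\<^sup>+w. indicator {v'} w \<partial>count_space (\<Omega> - {v}))"
          using v' by (subst nn_integral_indicator) auto
        also have "\<dots> \<le> ?b"
          using v' by (intro nn_integral_mono) (auto simp: indicator_def)
        also have "\<dots> \<le> ?a + ?b" by simp
        finally show ?thesis using True by (auto simp: indicator_def)
      qed (auto simp: indicator_def)
      have "emeasure (K (\<phi> v)) {y\<in>space SY. \<psi> y \<noteq> v} =
          (\<integral>\<^sup>+y. indicator {y\<in>space SY. \<psi> y \<noteq> v} y \<partial>K (\<phi> v))"
      proof (rule nn_integral_indicator[symmetric])
        have "{y\<in>space SY. \<psi> y \<noteq> v} = \<psi> -` (\<Omega> - {v}) \<inter> space SY"
          using measurable_space[OF \<psi>] by auto
        then show "{y\<in>space SY. \<psi> y \<noteq> v} \<in> sets (K (\<phi> v))"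
          using measurable_sets[OF \<psi>, of "\<Omega> - {v}"] K_sets \<phi> v by auto
      qed
      also have "\<dots> \<le> (\<integral>\<^sup>+y. indicator (- S v) (\<phi> v, y) +
          (\<integral>\<^sup>+v'. indicator (S v') (\<phi> v', y) \<partial>count_space (\<Omega> - {v})) \<partial>K (\<phi> v))"
        using pw by (intro nn_integral_mono) (simp add: sp)
      also have "\<dots> = miss v (\<phi> v) + (\<integral>\<^sup>+y. \<integral>\<^sup>+v'. indicator (S v') (\<phi> v', y)
          \<partial>count_space (\<Omega> - {v}) \<partial>K (\<phi> v))"
        unfolding miss_def using v \<Omega>
        by (intro nn_integral_add borel_measurable_nn_integral_count_space ind_meas) auto
      also have "(\<integral>\<^sup>+y. \<integral>\<^sup>+v'. indicator (S v') (\<phi> v', y)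
          \<partial>count_space (\<Omega> - {v}) \<partial>K (\<phi> v)) = (\<integral>\<^sup>+v'. clash v' (\<phi> v', \<phi> v) \<partial>count_space (\<Omega> - {v}))"
        unfolding clash_def fst_conv snd_conv using \<Omega>
        by (intro nn_integral_count_space_nn_integral ind_meas) auto
      finally show ?thesis .
    qed
    then have "(\<integral>\<^sup>+v. emeasure (distr M (count_space \<Omega>) V) {v} *
        emeasure (K (\<phi> v)) {y\<in>space SY. \<psi> y \<noteq> v} \<partial>count_space \<Omega>) \<le> J \<phi>"
      unfolding J_def by (intro nn_integral_mono mult_mono) (auto simp: p)
    then show ?thesis
      using \<psi> decoding_error_le_nn_integral[of "distr M (count_space \<Omega>) V" SY K \<phi> \<psi>]
      by (auto intro: order_trans)
  qed
  let ?P = "PiM \<Omega> Q"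
  let ?confuse = "\<lambda>v v' x'. \<integral>\<^sup>+\<omega>. indicator {v} (V \<omega>) * indicator (S v') (x', Y \<omega>) \<partial>M :: ennreal"
  have Q_meas: "borel_measurable (Q v) = borel_measurable SX" for v
    using Q(2) by (intro measurable_cong_sets) auto
  have coord[measurable]: "(\<lambda>\<phi>. \<phi> v) \<in> ?P \<rightarrow>\<^sub>M Q v" if "v \<in> \<Omega>" for v
    using that by (rule measurable_component_singleton)
  have coord_SX[measurable]: "(\<lambda>\<phi>. \<phi> v) \<in> ?P \<rightarrow>\<^sub>M SX" if "v \<in> \<Omega>" for v
    using coord[OF that] measurable_cong_sets[OF refl Q(2)] by blast
  have atom_meas[measurable]: "(\<lambda>\<omega>. indicator {v} (V \<omega>) :: ennreal) \<in> borel_measurable M" for v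
    by (rule measurable_compose[OF V]) simp
  have Y_ind[measurable]: "(\<lambda>z. indicator (S v) (fst z, Y (snd z)) :: ennreal) \<in> borel_measurable (SX \<Otimes>\<^sub>M M)"
    if "v \<in> \<Omega>" for v
    using that by (intro measurable_compose[OF _ S_meas(1)]) auto
  have confuse_meas[measurable]: "?confuse v v' \<in> borel_measurable SX" if "v \<in> \<Omega>" "v' \<in> \<Omega>" for v v'
    using Y_ind[OF that(2)] measurable_compose[OF measurable_snd atom_meas[of v]]
    by (intro borel_measurable_nn_integral) (auto simp: split_def)
  have sum_atoms: "(\<integral>\<^sup>+v. indicator {v} (V \<omega>) * h v \<partial>count_space \<Omega>) = h (V \<omega>)"
    if "\<omega> \<in> space M" for \<omega> and h :: "'v \<Rightarrow> ennreal"
    using V_in[OF that] by (subst nn_integral_count_space'[of "{V \<omega>}"]) auto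
  have mean_miss: "(\<integral>\<^sup>+\<phi>. miss v (\<phi> v) \<partial>?P) = (\<integral>\<^sup>+x. miss v x \<partial>Q v)" if v: "v \<in> \<Omega>" for v
    using nn_integral_distr[OF coord[OF v], of "miss v"] Q.PiM_component[OF v] v
    by (simp add: Q_meas miss)
  have mean_clash: "(\<integral>\<^sup>+\<phi>. clash v' (\<phi> v', \<phi> v) \<partial>?P) = (\<integral>\<^sup>+x'. \<integral>\<^sup>+x. clash v' (x', x) \<partial>Q v \<partial>Q v')"
    if v: "v \<in> \<Omega>" and v': "v' \<in> \<Omega>" "v' \<noteq> v" for v v'
  proof -
    have "clash v' \<in> borel_measurable (Q v' \<Otimes>\<^sub>M Q v)" using v' by measurable
    then have "(\<integral>\<^sup>+\<phi>. clash v' (\<phi> v', \<phi> v) \<partial>?P) = (\<integral>\<^sup>+z. clash v' z \<partial>(Q v' \<Otimes>\<^sub>M Q v))"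
      using v v' nn_integral_distr[of "\<lambda>\<phi>. (\<phi> v', \<phi> v)" ?P "Q v' \<Otimes>\<^sub>M Q v" "clash v'"]
        Q.distr_pair_of_coordinates[OF v'(1) v v'(2)] by simp
    also have "\<dots> = (\<integral>\<^sup>+x'. \<integral>\<^sup>+x. clash v' (x', x) \<partial>Q v \<partial>Q v')"
      by (rule Qv.nn_integral_fst[symmetric]) fact
    finally show ?thesis .
  qed
  \<comment> \<open>Averaging over the message glues the conditional laws back to the joint law of \<open>(V, X, Y)\<close>.\<close>
  have total_miss: "(\<integral>\<^sup>+v. p v * (\<integral>\<^sup>+x. miss v x \<partial>Q v) \<partial>count_space \<Omega>) =
      (\<integral>\<^sup>+\<omega>. indicator (- S (V \<omega>)) (X \<omega>, Y \<omega>) \<partial>M)"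
  proof -
    have "(\<integral>\<^sup>+v. p v * (\<integral>\<^sup>+x. miss v x \<partial>Q v) \<partial>count_space \<Omega>) =
        (\<integral>\<^sup>+v. \<integral>\<^sup>+\<omega>. indicator {v} (V \<omega>) * indicator (- S v) (X \<omega>, Y \<omega>) \<partial>M \<partial>count_space \<Omega>)"
    proof (intro nn_integral_cong)
      fix v assume "v \<in> space (count_space \<Omega>)"
      then have v: "v \<in> \<Omega>" by simp
      have "p v * (\<integral>\<^sup>+x. miss v x \<partial>Q v) = (\<integral>\<^sup>+\<omega>. indicator {v} (V \<omega>) * miss v (X \<omega>) \<partial>M)"
        unfolding p_def by (rule Q_int[OF miss[OF v]])
      also have "\<dots> = (\<integral>\<^sup>+\<omega>. indicator {v} (V \<omega>) * indicator (- S v) (X \<omega>, Y \<omega>) \<partial>M)"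
        unfolding miss_def
        by (rule channel_output_nn_integral[OF prob_space_axioms V X K out, symmetric])
           (use v in auto)
      finally show "p v * (\<integral>\<^sup>+x. miss v x \<partial>Q v) =
        (\<integral>\<^sup>+\<omega>. indicator {v} (V \<omega>) * indicator (- S v) (X \<omega>, Y \<omega>) \<partial>M)" .
    qed
    also have "\<dots> = (\<integral>\<^sup>+\<omega>. \<integral>\<^sup>+v. indicator {v} (V \<omega>) * indicator (- S v) (X \<omega>, Y \<omega>)
        \<partial>count_space \<Omega> \<partial>M)"
      by (rule nn_integral_count_space_nn_integral[OF \<Omega>, symmetric])
         (auto intro!: borel_measurable_times measurable_compose[OF _ S_meas(2)])
    also have "\<dots> = (\<integral>\<^sup>+\<omega>. indicator (- S (V \<omega>)) (X \<omega>, Y \<omega>) \<partial>M)"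
      by (intro nn_integral_cong sum_atoms)
    finally show ?thesis .
  qed
  have confuse_eq: "p v * (\<integral>\<^sup>+x'. \<integral>\<^sup>+x. clash v' (x', x) \<partial>Q v \<partial>Q v') = (\<integral>\<^sup>+x'. ?confuse v v' x' \<partial>Q v')"
    if v: "v \<in> \<Omega>" and v': "v' \<in> \<Omega>" for v v'
  proof -
    have cl: "clash v' \<in> borel_measurable (Q v' \<Otimes>\<^sub>M Q v)" using v' by measurable
    have "p v * (\<integral>\<^sup>+x'. \<integral>\<^sup>+x. clash v' (x', x) \<partial>Q v \<partial>Q v') =
        (\<integral>\<^sup>+x'. p v * (\<integral>\<^sup>+x. clash v' (x', x) \<partial>Q v) \<partial>Q v')"
      using Qv.borel_measurable_nn_integral_fst[OF cl] by (rule nn_integral_cmult[symmetric])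
    also have "\<dots> = (\<integral>\<^sup>+x'. ?confuse v v' x' \<partial>Q v')"
    proof (intro nn_integral_cong)
      fix x' assume "x' \<in> space (Q v')"
      then have x': "x' \<in> space SX" using sets_eq_imp_space_eq[OF Q(2)] by simp
      have ind: "(\<lambda>z. indicator (S v') (x', snd z) :: ennreal) \<in> borel_measurable (SX \<Otimes>\<^sub>M SY)"
        using measurable_compose[OF measurable_snd measurable_Pair1'[OF x']] S_meas(1)[OF v']
        by (rule measurable_compose)
      have "p v * (\<integral>\<^sup>+x. clash v' (x', x) \<partial>Q v) =
          (\<integral>\<^sup>+\<omega>. indicator {v} (V \<omega>) * clash v' (x', X \<omega>) \<partial>M)"
        unfolding p_def using measurable_compose[OF measurable_Pair1'[OF x'] clash[OF v']] by (rule Q_int)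
      also have "\<dots> = ?confuse v v' x'"
        unfolding clash_def fst_conv snd_conv
        using channel_output_nn_integral[OF prob_space_axioms V X K out,
            of "{v}" "\<lambda>z. indicator (S v') (x', snd z)"] v ind
        by simp
      finally show "p v * (\<integral>\<^sup>+x. clash v' (x', x) \<partial>Q v) = ?confuse v v' x'" .
    qed
    finally show ?thesis .
  qed
  have total_clash: "(\<integral>\<^sup>+v. \<integral>\<^sup>+v'. \<integral>\<^sup>+x'. ?confuse v v' x' \<partial>Q v' \<partial>count_space \<Omega> \<partial>count_space \<Omega>) =
      (\<integral>\<^sup>+v'. \<integral>\<^sup>+x'. \<integral>\<^sup>+\<omega>. indicator (S v') (x', Y \<omega>) \<partial>M \<partial>Q v' \<partial>count_space \<Omega>)"
  proof -
    have "(\<integral>\<^sup>+v. \<integral>\<^sup>+v'. \<integral>\<^sup>+x'. ?confuse v v' x' \<partial>Q v' \<partial>count_space \<Omega> \<partial>count_space \<Omega>) =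
        (\<integral>\<^sup>+v'. \<integral>\<^sup>+v. \<integral>\<^sup>+x'. ?confuse v v' x' \<partial>Q v' \<partial>count_space \<Omega> \<partial>count_space \<Omega>)"
      by (rule nn_integral_count_space_nn_integral[OF \<Omega>]) simp
    also have "\<dots> = (\<integral>\<^sup>+v'. \<integral>\<^sup>+x'. \<integral>\<^sup>+v. ?confuse v v' x' \<partial>count_space \<Omega> \<partial>Q v' \<partial>count_space \<Omega>)"
      by (intro nn_integral_cong nn_integral_count_space_nn_integral[OF \<Omega>, symmetric]) simp
    also have "\<dots> = (\<integral>\<^sup>+v'. \<integral>\<^sup>+x'. \<integral>\<^sup>+\<omega>. indicator (S v') (x', Y \<omega>) \<partial>M \<partial>Q v' \<partial>count_space \<Omega>)"
    proof (intro nn_integral_cong)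
      fix v' x' assume "v' \<in> space (count_space \<Omega>)" "x' \<in> space (Q v')"
      then have v': "v' \<in> \<Omega>" and x': "x' \<in> space SX" using sets_eq_imp_space_eq[OF Q(2)] by auto
      have "(\<integral>\<^sup>+v. ?confuse v v' x' \<partial>count_space \<Omega>) =
          (\<integral>\<^sup>+\<omega>. \<integral>\<^sup>+v. indicator {v} (V \<omega>) * indicator (S v') (x', Y \<omega>) \<partial>count_space \<Omega> \<partial>M)"
        using v' x' by (intro nn_integral_count_space_nn_integral[OF \<Omega>, symmetric])
          (auto intro!: borel_measurable_times measurable_compose[OF _ S_meas(1)])
      also have "\<dots> = (\<integral>\<^sup>+\<omega>. indicator (S v') (x', Y \<omega>) \<partial>M)"
        by (intro nn_integral_cong sum_atoms)
      finally show "(\<integral>\<^sup>+v. ?confuse v v' x' \<partial>count_space \<Omega>) = (\<integral>\<^sup>+\<omega>. indicator (S v') (x', Y \<omega>) \<partial>M)" .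
    qed
    finally show ?thesis .
  qed
  have clash_meas: "(\<lambda>\<phi>. clash v' (\<phi> v', \<phi> v)) \<in> borel_measurable ?P"
    if "v \<in> \<Omega>" "v' \<in> \<Omega>" for v v'
    using that by (intro measurable_compose[OF _ clash]) auto
  have summand_meas: "(\<lambda>\<phi>. \<integral>\<^sup>+v'. clash v' (\<phi> v', \<phi> v) \<partial>count_space (\<Omega> - {v})) \<in> borel_measurable ?P"
    if "v \<in> \<Omega>" for v
    using that \<Omega> by (intro borel_measurable_nn_integral_count_space clash_meas) auto
  have miss_meas: "(\<lambda>\<phi>. miss v (\<phi> v)) \<in> borel_measurable ?P" if "v \<in> \<Omega>" for v
    using that by (intro measurable_compose[OF _ miss]) auto
  have term_meas: "(\<lambda>\<phi>. p v * (miss v (\<phi> v) +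
      (\<integral>\<^sup>+v'. clash v' (\<phi> v', \<phi> v) \<partial>count_space (\<Omega> - {v})))) \<in> borel_measurable ?P"
    if "v \<in> \<Omega>" for v
  proof -
    note [measurable] = summand_meas[OF that] miss_meas[OF that]
    show ?thesis by measurable
  qed
  have J_meas: "J \<in> borel_measurable ?P"
    unfolding J_def[abs_def] using \<Omega> term_meas by (rule borel_measurable_nn_integral_count_space)
  have "(\<integral>\<^sup>+\<phi>. J \<phi> \<partial>?P) = (\<integral>\<^sup>+v. \<integral>\<^sup>+\<phi>. p v * (miss v (\<phi> v) +
      (\<integral>\<^sup>+v'. clash v' (\<phi> v', \<phi> v) \<partial>count_space (\<Omega> - {v}))) \<partial>?P \<partial>count_space \<Omega>)"
    unfolding J_def using \<Omega> term_meas by (rule nn_integral_count_space_nn_integral)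
  also have "\<dots> \<le> (\<integral>\<^sup>+v. p v * (\<integral>\<^sup>+x. miss v x \<partial>Q v) +
      (\<integral>\<^sup>+v'. \<integral>\<^sup>+x'. ?confuse v v' x' \<partial>Q v' \<partial>count_space \<Omega>) \<partial>count_space \<Omega>)"
  proof (intro nn_integral_mono)
    fix v assume "v \<in> space (count_space \<Omega>)"
    then have v: "v \<in> \<Omega>" by simp
    have "(\<integral>\<^sup>+\<phi>. p v * (miss v (\<phi> v) +
        (\<integral>\<^sup>+v'. clash v' (\<phi> v', \<phi> v) \<partial>count_space (\<Omega> - {v}))) \<partial>?P) =
        p v * ((\<integral>\<^sup>+x. miss v x \<partial>Q v) +
          (\<integral>\<^sup>+\<phi>. \<integral>\<^sup>+v'. clash v' (\<phi> v', \<phi> v) \<partial>count_space (\<Omega> - {v}) \<partial>?P))"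
      using summand_meas[OF v] miss_meas[OF v]
      by (simp add: nn_integral_cmult nn_integral_add mean_miss[OF v])
    also have "(\<integral>\<^sup>+\<phi>. \<integral>\<^sup>+v'. clash v' (\<phi> v', \<phi> v) \<partial>count_space (\<Omega> - {v}) \<partial>?P) =
        (\<integral>\<^sup>+v'. \<integral>\<^sup>+\<phi>. clash v' (\<phi> v', \<phi> v) \<partial>?P \<partial>count_space (\<Omega> - {v}))"
      using \<Omega> v by (intro nn_integral_count_space_nn_integral clash_meas) auto
    also have "\<dots> = (\<integral>\<^sup>+v'. \<integral>\<^sup>+x'. \<integral>\<^sup>+x. clash v' (x', x) \<partial>Q v \<partial>Q v' \<partial>count_space (\<Omega> - {v}))"
      using v by (intro nn_integral_cong mean_clash) auto
    \<comment> \<open>Readmitting \<open>v' = v\<close> frees the range of \<open>v'\<close> from \<open>v\<close>, so that for each \<open>v'\<close> the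
      sum over \<open>v\<close> recovers the law of \<open>Y\<close>.\<close>
    also have "\<dots> \<le> (\<integral>\<^sup>+v'. \<integral>\<^sup>+x'. \<integral>\<^sup>+x. clash v' (x', x) \<partial>Q v \<partial>Q v' \<partial>count_space \<Omega>)"
      by (subst (1 2) nn_integral_count_space_indicator)
         (auto intro!: nn_integral_mono simp: indicator_def)
    also have "p v * ((\<integral>\<^sup>+x. miss v x \<partial>Q v) + \<dots>) =
        p v * (\<integral>\<^sup>+x. miss v x \<partial>Q v) + (\<integral>\<^sup>+v'. \<integral>\<^sup>+x'. ?confuse v v' x' \<partial>Q v' \<partial>count_space \<Omega>)"
    proof -
      have "p v * (\<integral>\<^sup>+v'. \<integral>\<^sup>+x'. \<integral>\<^sup>+x. clash v' (x', x) \<partial>Q v \<partial>Q v' \<partial>count_space \<Omega>) =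
          (\<integral>\<^sup>+v'. p v * (\<integral>\<^sup>+x'. \<integral>\<^sup>+x. clash v' (x', x) \<partial>Q v \<partial>Q v') \<partial>count_space \<Omega>)"
        by (rule nn_integral_cmult[symmetric]) simp
      also have "\<dots> = (\<integral>\<^sup>+v'. \<integral>\<^sup>+x'. ?confuse v v' x' \<partial>Q v' \<partial>count_space \<Omega>)"
        using v by (intro nn_integral_cong confuse_eq) auto
      finally show ?thesis by (simp add: distrib_left)
    qed
    finally show "(\<integral>\<^sup>+\<phi>. p v * (miss v (\<phi> v) +
        (\<integral>\<^sup>+v'. clash v' (\<phi> v', \<phi> v) \<partial>count_space (\<Omega> - {v}))) \<partial>?P) \<le>
        p v * (\<integral>\<^sup>+x. miss v x \<partial>Q v) + (\<integral>\<^sup>+v'. \<integral>\<^sup>+x'. ?confuse v v' x' \<partial>Q v' \<partial>count_space \<Omega>)"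
      by (simp add: mult_left_mono add_left_mono)
  qed
  also have "\<dots> = (\<integral>\<^sup>+\<omega>. indicator (- S (V \<omega>)) (X \<omega>, Y \<omega>) \<partial>M) +
      (\<integral>\<^sup>+v. \<integral>\<^sup>+x. \<integral>\<^sup>+\<omega>. indicator (S v) (x, Y \<omega>) \<partial>M \<partial>Q v \<partial>count_space \<Omega>)"
    by (simp add: nn_integral_add total_miss total_clash)
  finally have mean: "(\<integral>\<^sup>+\<phi>. J \<phi> \<partial>?P) \<le> \<dots>" .
  obtain \<phi> where \<phi>: "\<phi> \<in> space ?P" "J \<phi> \<le> (\<integral>\<^sup>+\<phi>. J \<phi> \<partial>?P)"
    using Q.exists_le_nn_integral[OF J_meas] by blast
  have \<phi>_SX: "\<phi> v \<in> space SX" if "v \<in> \<Omega>" for v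
    using measurable_space[OF coord_SX[OF that] \<phi>(1)] .
  from code[of \<phi>, OF \<phi>_SX] obtain \<psi> where \<psi>: "\<psi> \<in> SY \<rightarrow>\<^sub>M count_space \<Omega>"
    "ennreal (decoding_error (distr M (count_space \<Omega>) V) SY K \<phi> \<psi>) \<le> J \<phi>" by blast
  show ?thesis
    using \<phi>_SX \<psi>(1) order_trans[OF \<psi>(2) order_trans[OF \<phi>(2) mean]] by blast
qed

section \<open>Likelihood-ratio regions\<close>

text \<open>A Markov inequality under the product law. On \<open>S v\<close> one has \<open>1 \<le> (p v / c) g\<close> for
  \<open>p v = P(V = v)\<close>, so a confusion with \<open>v\<close> has probability at most \<open>1 / c\<close> times
  \<open>p v\<close> times the mean of \<open>\<integral> g(x, y) P\<^sub>Y(dy)\<close> under \<open>Q v\<close>. Because of the weight \<open>p v\<close> the conditional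
  laws again sum up to the law of \<open>X\<close>, and the infinitely many messages together contribute no
  more than the total mass of \<open>g\<close>.\<close>
lemma confusion_mass_le:
  fixes V :: "'a \<Rightarrow> 'v" and X :: "'a \<Rightarrow> 'x" and Y :: "'a \<Rightarrow> 'y" and g :: "'x \<times> 'y \<Rightarrow> ennreal"
  assumes "prob_space M" and \<Omega>: "countable \<Omega>"
    and V: "V \<in> M \<rightarrow>\<^sub>M count_space \<Omega>" and X: "X \<in> M \<rightarrow>\<^sub>M SX" and Y: "Y \<in> M \<rightarrow>\<^sub>M SY"
    and g: "g \<in> borel_measurable (SX \<Otimes>\<^sub>M SY)"
    and mass: "(\<integral>\<^sup>+z. g z \<partial>(distr M SX X \<Otimes>\<^sub>M distr M SY Y)) \<le> 1"
    and Q: "\<And>v. sets (Q v) = sets SX"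
    and Q_int: "\<And>v f. f \<in> borel_measurable SX \<Longrightarrow>
      emeasure M (V -` {v} \<inter> space M) * (\<integral>\<^sup>+x. f x \<partial>Q v) =
      (\<integral>\<^sup>+\<omega>. indicator {v} (V \<omega>) * f (X \<omega>) \<partial>M)"
    and c: "c > 0"
    and S: "\<And>v z. z \<in> S v \<Longrightarrow> ennreal c / emeasure M (V -` {v} \<inter> space M) < g z"
  shows "(\<integral>\<^sup>+v. \<integral>\<^sup>+x. \<integral>\<^sup>+\<omega>. indicator (S v) (x, Y \<omega>) \<partial>M \<partial>Q v \<partial>count_space \<Omega>) \<le> ennreal (1 / c)"
proof -
  interpret prob_space M by fact
  interpret PY: prob_space "distr M SY Y" using Y by (rule prob_space_distr)
  have V_in: "V \<omega> \<in> \<Omega>" if "\<omega> \<in> space M" for \<omega> using measurable_space[OF V that] by simp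
  define p where "p v = emeasure M (V -` {v} \<inter> space M)" for v
  define G where "G x = (\<integral>\<^sup>+y. g (x, y) \<partial>distr M SY Y)" for x
  have g': "g \<in> borel_measurable (SX \<Otimes>\<^sub>M distr M SY Y)" "g \<in> borel_measurable (distr M SX X \<Otimes>\<^sub>M distr M SY Y)"
    using g by simp_all
  have G: "G \<in> borel_measurable SX"
    unfolding G_def[abs_def] by (rule PY.borel_measurable_nn_integral_fst[OF g'(1)])
  have atom_meas: "(\<lambda>\<omega>. indicator {v} (V \<omega>) :: ennreal) \<in> borel_measurable M" for v
    by (rule measurable_compose[OF V]) simp
  have markov: "indicator (S v) z \<le> p v / ennreal c * g z" for v z
  proof (cases "z \<in> S v")
    case True
    then have lt: "ennreal c / p v < g z" using S by (simp add: p_def)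
    then have "p v \<noteq> 0" using c by (auto simp: ennreal_divide_zero top_unique)
    then obtain r where r: "p v = ennreal r" "0 < r"
      using emeasure_eq_measure[of "V -` {v} \<inter> space M"] by (cases "p v") (auto simp: p_def)
    have "(1::ennreal) = p v / ennreal c * (ennreal c / p v)"
      using c r by (simp add: divide_ennreal ennreal_mult[symmetric])
    also have "\<dots> \<le> p v / ennreal c * g z"
      using lt by (intro mult_left_mono) auto
    finally show ?thesis using True by simp
  qed simp
  have "(\<integral>\<^sup>+x. \<integral>\<^sup>+\<omega>. indicator (S v) (x, Y \<omega>) \<partial>M \<partial>Q v) \<le>
      1 / ennreal c * (\<integral>\<^sup>+\<omega>. indicator {v} (V \<omega>) * G (X \<omega>) \<partial>M)" for v
  proof -
    have "(\<integral>\<^sup>+x. \<integral>\<^sup>+\<omega>. indicator (S v) (x, Y \<omega>) \<partial>M \<partial>Q v) \<le> (\<integral>\<^sup>+x. p v / ennreal c * G x \<partial>Q v)"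
    proof (rule nn_integral_mono)
      fix x assume "x \<in> space (Q v)"
      then have x: "x \<in> space SX" using sets_eq_imp_space_eq[OF Q] by simp
      have gx: "(\<lambda>y. g (x, y)) \<in> borel_measurable SY"
        using measurable_compose[OF measurable_Pair1'[OF x] g] .
      have "(\<integral>\<^sup>+\<omega>. indicator (S v) (x, Y \<omega>) \<partial>M) \<le> (\<integral>\<^sup>+\<omega>. p v / ennreal c * g (x, Y \<omega>) \<partial>M)"
        by (intro nn_integral_mono markov)
      also have "\<dots> = p v / ennreal c * G x"
        using measurable_compose[OF Y gx] Y gx by (simp add: nn_integral_cmult G_def nn_integral_distr)
      finally show "(\<integral>\<^sup>+\<omega>. indicator (S v) (x, Y \<omega>) \<partial>M) \<le> p v / ennreal c * G x" .
    qed
    also have "\<dots> = p v / ennreal c * (\<integral>\<^sup>+x. G x \<partial>Q v)"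
      using G measurable_cong_sets[OF Q refl] by (intro nn_integral_cmult) blast
    also have "\<dots> = 1 / ennreal c * (p v * (\<integral>\<^sup>+x. G x \<partial>Q v))"
      by (simp add: divide_ennreal_def mult_ac)
    finally show ?thesis by (simp only: p_def Q_int[OF G])
  qed
  then have "(\<integral>\<^sup>+v. \<integral>\<^sup>+x. \<integral>\<^sup>+\<omega>. indicator (S v) (x, Y \<omega>) \<partial>M \<partial>Q v \<partial>count_space \<Omega>) \<le>
      (\<integral>\<^sup>+v. 1 / ennreal c * (\<integral>\<^sup>+\<omega>. indicator {v} (V \<omega>) * G (X \<omega>) \<partial>M) \<partial>count_space \<Omega>)"
    by (intro nn_integral_mono)
  also have "\<dots> = 1 / ennreal c * (\<integral>\<^sup>+v. \<integral>\<^sup>+\<omega>. indicator {v} (V \<omega>) * G (X \<omega>) \<partial>M \<partial>count_space \<Omega>)"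
    by (intro nn_integral_cmult) simp
  also have "(\<integral>\<^sup>+v. \<integral>\<^sup>+\<omega>. indicator {v} (V \<omega>) * G (X \<omega>) \<partial>M \<partial>count_space \<Omega>) =
      (\<integral>\<^sup>+\<omega>. \<integral>\<^sup>+v. indicator {v} (V \<omega>) * G (X \<omega>) \<partial>count_space \<Omega> \<partial>M)"
    using atom_meas measurable_compose[OF X G]
    by (intro nn_integral_count_space_nn_integral[OF \<Omega>, symmetric]) auto
  also have "\<dots> = (\<integral>\<^sup>+\<omega>. G (X \<omega>) \<partial>M)"
  proof (rule nn_integral_cong)
    fix \<omega> assume "\<omega> \<in> space M"
    then show "(\<integral>\<^sup>+v. indicator {v} (V \<omega>) * G (X \<omega>) \<partial>count_space \<Omega>) = G (X \<omega>)"
      using V_in by (subst nn_integral_count_space'[of "{V \<omega>}"]) auto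
  qed
  also have "\<dots> = (\<integral>\<^sup>+x. G x \<partial>distr M SX X)"
    using X G by (simp add: nn_integral_distr)
  also have "\<dots> = (\<integral>\<^sup>+z. g z \<partial>(distr M SX X \<Otimes>\<^sub>M distr M SY Y))"
    unfolding G_def by (rule PY.nn_integral_fst[OF g'(2)])
  also have "1 / ennreal c * \<dots> \<le> 1 / ennreal c * 1"
    using mass by (rule mult_left_mono) simp
  also have "\<dots> = ennreal (1 / c)"
    using c divide_ennreal[of 1 c] by simp
  finally show ?thesis by (simp add: mult_left_mono)
qed

text \<open>The regions \<open>S v\<close> require \<open>g\<close> to exceed \<open>c / p v\<close>: likelier messages are accepted
  more readily, which keeps the sum over messages finite. The confusion bound requires that \<open>g\<close>
  have total mass at most one under the product of the marginals; this holds because the mass is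
  that of the absolutely continuous part of the joint law.\<close>
lemma threshold_code_exists:
  fixes V :: "'a \<Rightarrow> 'v" and X :: "'a \<Rightarrow> 'x" and Y :: "'a \<Rightarrow> 'y" and g :: "'x \<times> 'y \<Rightarrow> ennreal"
  assumes "prob_space M" and \<Omega>: "countable \<Omega>"
    and V: "V \<in> M \<rightarrow>\<^sub>M count_space \<Omega>" and X: "X \<in> M \<rightarrow>\<^sub>M SX"
    and K: "K \<in> SX \<rightarrow>\<^sub>M prob_algebra SY"
    and out: "channel_output M (count_space \<Omega>) SX SY K V X Y"
    and deriv: "is_RN_deriv (distr M SX X \<Otimes>\<^sub>M distr M SY Y)
      (distr M (SX \<Otimes>\<^sub>M SY) (\<lambda>\<omega>. (X \<omega>, Y \<omega>))) g"
    and c: "c > 0"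
  shows "\<exists>\<phi>\<in>\<Omega> \<rightarrow> space SX. \<exists>\<psi>\<in>SY \<rightarrow>\<^sub>M count_space \<Omega>.
    decoding_error (distr M (count_space \<Omega>) V) SY K \<phi> \<psi> \<le>
      measure M {\<omega>\<in>space M. g (X \<omega>, Y \<omega>) \<le>
        ennreal c / emeasure (distr M (count_space \<Omega>) V) {V \<omega>}} + 1 / c"
proof -
  interpret prob_space M by fact
  have Y: "Y \<in> M \<rightarrow>\<^sub>M SY" using out by (simp add: channel_output_def)
  have V_in: "V \<omega> \<in> \<Omega>" if "\<omega> \<in> space M" for \<omega> using measurable_space[OF V that] by simp
  define p where "p v = emeasure M (V -` {v} \<inter> space M)" for v
  have p: "emeasure (distr M (count_space \<Omega>) V) {v} = p v" if "v \<in> \<Omega>" for v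
    using that V by (simp add: p_def emeasure_distr)
  have g: "g \<in> borel_measurable (SX \<Otimes>\<^sub>M SY)"
  proof -
    have "sets (distr M SX X \<Otimes>\<^sub>M distr M SY Y) = sets (SX \<Otimes>\<^sub>M SY)"
      by (intro sets_pair_measure_cong) simp_all
    then show ?thesis
      using deriv measurable_cong_sets[of _ "SX \<Otimes>\<^sub>M SY" borel borel] unfolding is_RN_deriv_def by blast
  qed
  have XY: "(\<lambda>\<omega>. (X \<omega>, Y \<omega>)) \<in> M \<rightarrow>\<^sub>M SX \<Otimes>\<^sub>M SY" using X Y by simp
  note [measurable] = V g XY
  interpret PXY: prob_space "distr M (SX \<Otimes>\<^sub>M SY) (\<lambda>\<omega>. (X \<omega>, Y \<omega>))"
    using XY by (rule prob_space_distr)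
  have mass: "(\<integral>\<^sup>+z. g z \<partial>(distr M SX X \<Otimes>\<^sub>M distr M SY Y)) \<le> 1" (is "integral\<^sup>N ?\<nu> g \<le> 1")
  proof -
    obtain N where "\<forall>B\<in>sets ?\<nu>. emeasure (distr M (SX \<Otimes>\<^sub>M SY) (\<lambda>\<omega>. (X \<omega>, Y \<omega>))) B =
        (\<integral>\<^sup>+z\<in>B. g z \<partial>?\<nu>) + emeasure (distr M (SX \<Otimes>\<^sub>M SY) (\<lambda>\<omega>. (X \<omega>, Y \<omega>))) (B \<inter> N)"
      using deriv unfolding is_RN_deriv_def by blast
    from this[rule_format, OF sets.top]
    have "(\<integral>\<^sup>+z\<in>space ?\<nu>. g z \<partial>?\<nu>) \<le> emeasure (distr M (SX \<Otimes>\<^sub>M SY) (\<lambda>\<omega>. (X \<omega>, Y \<omega>))) (space ?\<nu>)"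
      by (simp only: add_increasing2 zero_le order_refl)
    also have "\<dots> \<le> 1" by (rule PXY.emeasure_le_1)
    also have "(\<integral>\<^sup>+z\<in>space ?\<nu>. g z \<partial>?\<nu>) = integral\<^sup>N ?\<nu> g"
      by (intro nn_integral_cong) simp
    finally show ?thesis .
  qed
  obtain Q where Q_law: "\<forall>v. prob_space (Q v) \<and> sets (Q v) = sets SX \<and> (\<forall>f\<in>borel_measurable SX.
      emeasure M (V -` {v} \<inter> space M) * (\<integral>\<^sup>+x. f x \<partial>Q v) =
      (\<integral>\<^sup>+\<omega>. indicator {v} (V \<omega>) * f (X \<omega>) \<partial>M))"
    using choice[OF allI[OF conditional_law_given_atom[OF prob_space_axioms V X]]] ..
  then have Q: "\<And>v. prob_space (Q v)" "\<And>v. sets (Q v) = sets SX"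
    and Q_int: "\<And>v f. f \<in> borel_measurable SX \<Longrightarrow>
      emeasure M (V -` {v} \<inter> space M) * (\<integral>\<^sup>+x. f x \<partial>Q v) =
      (\<integral>\<^sup>+\<omega>. indicator {v} (V \<omega>) * f (X \<omega>) \<partial>M)"
    by blast+
  define S where "S v = {z\<in>space (SX \<Otimes>\<^sub>M SY). ennreal c / p v < g z}" for v
  have S: "S v \<in> sets (SX \<Otimes>\<^sub>M SY)" for v
    unfolding S_def by measurable
  let ?E = "{\<omega>\<in>space M. g (X \<omega>, Y \<omega>) \<le> ennreal c / emeasure (distr M (count_space \<Omega>) V) {V \<omega>}}"
  have "(\<lambda>\<omega>. ennreal c / emeasure (distr M (count_space \<Omega>) V) {V \<omega>}) \<in> borel_measurable M"
    by (rule measurable_compose[OF V]) simp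
  then have E: "?E \<in> sets M" by measurable
  have "(\<integral>\<^sup>+\<omega>. indicator (- S (V \<omega>)) (X \<omega>, Y \<omega>) \<partial>M) = (\<integral>\<^sup>+\<omega>. indicator ?E \<omega> \<partial>M)"
    using measurable_space[OF XY] V_in
    by (intro nn_integral_cong) (auto simp: S_def p indicator_def not_less)
  also have "\<dots> = ennreal (measure M ?E)"
    using E by (simp add: emeasure_eq_measure)
  finally have miss: "(\<integral>\<^sup>+\<omega>. indicator (- S (V \<omega>)) (X \<omega>, Y \<omega>) \<partial>M) = ennreal (measure M ?E)" .
  have clash: "(\<integral>\<^sup>+v. \<integral>\<^sup>+x. \<integral>\<^sup>+\<omega>. indicator (S v) (x, Y \<omega>) \<partial>M \<partial>Q v \<partial>count_space \<Omega>) \<le> ennreal (1 / c)"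
    by (rule confusion_mass_le[OF prob_space_axioms \<Omega> V X Y g mass Q(2) Q_int c]) (auto simp: S_def p_def)
  obtain \<phi> \<psi> where code: "\<phi> \<in> \<Omega> \<rightarrow> space SX" "\<psi> \<in> SY \<rightarrow>\<^sub>M count_space \<Omega>"
    and "ennreal (decoding_error (distr M (count_space \<Omega>) V) SY K \<phi> \<psi>) \<le>
      (\<integral>\<^sup>+\<omega>. indicator (- S (V \<omega>)) (X \<omega>, Y \<omega>) \<partial>M) +
      (\<integral>\<^sup>+v. \<integral>\<^sup>+x. \<integral>\<^sup>+\<omega>. indicator (S v) (x, Y \<omega>) \<partial>M \<partial>Q v \<partial>count_space \<Omega>)"
    using random_coding[where S = S and Q = Q, OF prob_space_axioms \<Omega> V X K out S Q Q_int] by blast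
  then have "ennreal (decoding_error (distr M (count_space \<Omega>) V) SY K \<phi> \<psi>) \<le>
      ennreal (measure M ?E) + ennreal (1 / c)"
    using clash unfolding miss by (meson add_left_mono order_trans)
  also have "\<dots> = ennreal (measure M ?E + 1 / c)"
    using c by (intro ennreal_plus[symmetric]) auto
  finally have "decoding_error (distr M (count_space \<Omega>) V) SY K \<phi> \<psi> \<le> measure M ?E + 1 / c"
    using c by (subst (asm) ennreal_le_iff) auto
  then show ?thesis using code by blast
qed

text \<open>The threshold with \<open>c = exp (n \<gamma>)\<close> is the logarithmic condition divided by \<open>n\<close>. The
  equivalence survives at the extreme values: for \<open>p = 0\<close> both sides hold for every \<open>u\<close>, for
  \<open>u = 0\<close> both hold, and for \<open>u = \<infinity>\<close> and \<open>p > 0\<close> both fail.\<close>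
lemma log_likelihood_threshold:
  assumes n: "n > 0" and p: "p \<le> 1"
  shows "ereal (1 / real n) * ln_ext u \<le> ereal (1 / real n) * ln_ext (1 / p) + ereal \<gamma> \<longleftrightarrow>
    u \<le> ennreal (exp (real n * \<gamma>)) / p"
proof (cases "p = 0")
  case True
  then show ?thesis using n by (simp add: ln_ext_def ennreal_divide_zero)
next
  case False
  then obtain r where r: "p = ennreal r" "0 < r"
    using p by (cases p) (auto simp: top_unique)
  have inv: "ln_ext (1 / p) = ereal (- ln r)"
    using r by (auto simp: ln_ext_def divide_ennreal ln_div simp flip: ennreal_1)
  have thr: "ennreal (exp (real n * \<gamma>)) / p = ennreal (exp (real n * \<gamma>) / r)"
    using r by (simp add: divide_ennreal)
  show ?thesis
  proof (cases u)
    case (real s)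
    show ?thesis
    proof (cases "s = 0")
      case True
      then show ?thesis using n real by (simp add: ln_ext_def)
    next
      case False
      then have s: "0 < s" using real by simp
      have "1 / real n * ln s \<le> 1 / real n * (- ln r) + \<gamma> \<longleftrightarrow> ln s \<le> real n * \<gamma> - ln r"
        using n by (simp add: field_simps)
      also have "real n * \<gamma> - ln r = ln (exp (real n * \<gamma>) / r)"
        using r by (simp add: ln_div)
      also have "ln s \<le> \<dots> \<longleftrightarrow> s \<le> exp (real n * \<gamma>) / r"
        using s r by (intro ln_le_cancel_iff) auto
      finally show ?thesis
        using n real s r unfolding inv thr by (simp add: ln_ext_def)
    qed
  next
    case top
    then show ?thesis using n unfolding inv thr by (simp add: ln_ext_def top_unique)
  qed
qed

section \<open>Existence of joint source-channel codes\<close>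

text \<open>Blocks over a countable alphabet form a countable discrete space, so for each blocklength
  this is the one-shot bound with \<open>c = exp (n \<gamma>)\<close>.\<close>
theorem lemma3p1:
  fixes A :: "'v set" and SX :: "'x measure" and SY :: "'y measure"
    and M :: "nat \<Rightarrow> 'a measure"
    and V :: "nat \<Rightarrow> 'a \<Rightarrow> nat \<Rightarrow> 'v"
    and X :: "nat \<Rightarrow> 'a \<Rightarrow> nat \<Rightarrow> 'x"
    and Y :: "nat \<Rightarrow> 'a \<Rightarrow> nat \<Rightarrow> 'y"
    and W :: "nat \<Rightarrow> (nat \<Rightarrow> 'x) \<Rightarrow> (nat \<Rightarrow> 'y) measure"
    and g :: "nat \<Rightarrow> (nat \<Rightarrow> 'x) \<times> (nat \<Rightarrow> 'y) \<Rightarrow> ennreal"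
    and \<gamma> :: real
  assumes source: "general_source A M V"
    and channel: "general_channel SX SY W"
    and input: "\<forall>n\<ge>1. X n \<in> M n \<rightarrow>\<^sub>M block n SX"
    and chan_output: "\<forall>n\<ge>1. channel_output (M n) (block n (count_space A)) (block n SX) (block n SY)
                   (W n) (V n) (X n) (Y n)"
    and deriv: "\<forall>n\<ge>1. is_RN_deriv
                   (distr (M n) (block n SX) (X n) \<Otimes>\<^sub>M distr (M n) (block n SY) (Y n))
                   (distr (M n) (block n SX \<Otimes>\<^sub>M block n SY) (\<lambda>\<omega>. (X n \<omega>, Y n \<omega>)))
                   (g n)"
    and gamma: "\<gamma> > 0"
  shows "\<forall>n\<ge>1. \<exists>\<phi> \<psi> \<epsilon>.
           joint_source_channel_code (distr (M n) (block n (count_space A)) (V n))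
             (block n SX) (block n SY) (W n) \<phi> \<psi> \<epsilon> \<and>
           \<epsilon> \<le> measure (M n) {\<omega> \<in> space (M n).
                 ereal (1 / real n) * ln_ext (g n (X n \<omega>, Y n \<omega>))
                 \<le> ereal (1 / real n) *
                     ln_ext (1 / emeasure (distr (M n) (block n (count_space A)) (V n)) {V n \<omega>})
                   + ereal \<gamma>}
             + exp (- real n * \<gamma>)"
proof (intro allI impI)
  fix n :: nat assume n: "n \<ge> 1"
  define \<Omega> where "\<Omega> = PiE {1..n} (\<lambda>_. A)"
  have A: "countable A" and prob: "prob_space (M n)" and V: "V n \<in> M n \<rightarrow>\<^sub>M block n (count_space A)"
    using source n by (auto simp: general_source_def)
  have discrete: "block n (count_space A) = count_space \<Omega>"
    unfolding \<Omega>_def using A by (intro count_space_PiM_finite) auto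
  have \<Omega>: "countable \<Omega>"
    unfolding \<Omega>_def using A by (intro countable_PiE) auto
  have K: "W n \<in> block n SX \<rightarrow>\<^sub>M prob_algebra (block n SY)"
    using channel n by (simp add: general_channel_def)
  interpret PV: prob_space "distr (M n) (count_space \<Omega>) (V n)"
    using V unfolding discrete by (rule prob_space.prob_space_distr[OF prob])
  obtain \<phi> \<psi> where code: "\<phi> \<in> \<Omega> \<rightarrow> space (block n SX)" "\<psi> \<in> block n SY \<rightarrow>\<^sub>M count_space \<Omega>"
    and err: "decoding_error (distr (M n) (count_space \<Omega>) (V n)) (block n SY) (W n) \<phi> \<psi> \<le>
      measure (M n) {\<omega>\<in>space (M n). g n (X n \<omega>, Y n \<omega>) \<le> ennreal (exp (real n * \<gamma>)) /
        emeasure (distr (M n) (count_space \<Omega>) (V n)) {V n \<omega>}} + 1 / exp (real n * \<gamma>)"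
    using threshold_code_exists[OF prob \<Omega> V[unfolded discrete] input[rule_format, OF n] K
        chan_output[rule_format, OF n, unfolded discrete] deriv[rule_format, OF n] exp_gt_zero]
    by blast
  have code': "joint_source_channel_code (distr (M n) (count_space \<Omega>) (V n)) (block n SX) (block n SY)
      (W n) \<phi> \<psi> (decoding_error (distr (M n) (count_space \<Omega>) (V n)) (block n SY) (W n) \<phi> \<psi>)"
    using code by (simp add: joint_source_channel_code_def)
  have exp_eq: "1 / exp (real n * \<gamma>) = exp (- real n * \<gamma>)"
    by (simp add: exp_minus inverse_eq_divide)
  have "0 < n" using n by simp
  note bound = err[unfolded exp_eq, folded log_likelihood_threshold[OF \<open>0 < n\<close> PV.emeasure_le_1]]
  show "\<exists>\<phi> \<psi> \<epsilon>.
           joint_source_channel_code (distr (M n) (block n (count_space A)) (V n))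
             (block n SX) (block n SY) (W n) \<phi> \<psi> \<epsilon> \<and>
           \<epsilon> \<le> measure (M n) {\<omega> \<in> space (M n).
                 ereal (1 / real n) * ln_ext (g n (X n \<omega>, Y n \<omega>))
                 \<le> ereal (1 / real n) *
                     ln_ext (1 / emeasure (distr (M n) (block n (count_space A)) (V n)) {V n \<omega>})
                   + ereal \<gamma>}
             + exp (- real n * \<gamma>)"
    unfolding discrete
    by (rule exI[of _ \<phi>], rule exI[of _ \<psi>], rule exI, rule conjI[OF code' bound])
qed

end
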